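(* Let $p$ be an odd prime. Then the binder of $\mathcal G((p,p))$, indexed by $(\mathbb Z_p^2)\times(\mathbb Z_p^2)$, is precisely $\widetilde{AG}(2,p^2)=\bigcup_{i=0}^4\mathcal B_i$ as defined below.
   Context: $\mathcal G((p,p))$: $G=\mathbb Z_p\oplus\mathbb Z_p$ ordered lexicographically, $\mathbb C^{p^2}$ with basis $\{e_j\}_{j\in G}$; fix a primitive $p$-th root of unity $\zeta$; $T^{(k)}e_j=e_{j+k}$, $M^{(\kappa)}e_j=\zeta^{\kappa_0j_0+\kappa_1j_1}e_j$. Let $c=((p-1)/2,(p-1)/2)$, $\mathcal I=\{i\in G:i<_{\mathrm{lex}}c\}$, $\phi_i=e_i-e_{-i-(1,1)}$; $\psi\in\mathbb R^{p^2(p^2-1)/2}$ is the concatenation of the $\phi_i$, $i\in\mathcal I$ in lexicographic order; $\pi(k,\kappa)=I_{(p^2-1)/2}\otimes(M^{(\kappa)}T^{(k)})$; $\mathcal G((p,p))=\{\pi(k,\kappa)\psi\}_{(k,\kappa)\in G\times G}$, an equiangular tight frame (ETF). Switching equivalence: $\Psi=U\Phi PD$, $U$ unitary, $P$ permutation, $D$ unimodular diagonal. An index set $\beta$ is a simplex if $\{\varphi_j\}_{j\in\beta}$ is switching equivalent to an ETF for a space of dimension $|\beta|-1$ with all pairwise inner products real and negative; the binder is the set of simplices. Writing $k=(k_0,k_1)$, $\kappa=(\kappa_0,\kappa_1)$: $\mathcal B_0=\{\{(k,\kappa):\kappa\in\mathbb Z_p^2\}:k\}$; $\mathcal B_1=\{\{(k,Ak+b):k\in\mathbb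 Z_p^2\}:A\in\mathrm{Sym}_2(\mathbb Z_p),b\in\mathbb Z_p^2\}$; $\mathcal B_2=\{\{((c_0,k_1),(\kappa_0,ak_1+b)):k_1,\kappa_0\in\mathbb Z_p\}:a,b,c_0\in\mathbb Z_p\}$; $\mathcal B_3=\{\{((k_0,c_1),(ak_0+b,\kappa_1)):k_0,\kappa_1\in\mathbb Z_p\}:a,b,c_1\in\mathbb Z_p\}$; $\mathcal B_4=\{\{((k_0,\alpha k_0+\beta),(\kappa_0,(-1/\alpha)\kappa_0+ak_0+b)):k_0,\kappa_0\in\mathbb Z_p\}:\alpha,\beta,a,b\in\mathbb Z_p,\alpha\ne0\}$. *)

theory Defs
  imports
    "HOL-Library.Product_Plus"
    "HOL-Combinatorics.Permutations"
    "Jordan_Normal_Form.Schur_Decomposition"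
    "Jordan_Normal_Form.VS_Connect"
    "Berlekamp_Zassenhaus.Finite_Field"
begin

section \<open>Frames, switching equivalence and the binder\<close>

text \<open>
  A frame is a family \<open>f\<close> of vectors of \<open>\<complex>\<^sup>d\<close>, of which the members with
  index in the finite set \<open>\<beta>\<close> are considered. Equal norms are required of an ETF, unit norms
  are not. The operation \<open>\<bullet>c\<close> is the Hermitian inner product, linear in the first argument.
\<close>

definition tight_frame_for :: "nat \<Rightarrow> complex vec set \<Rightarrow> 'i set \<Rightarrow> ('i \<Rightarrow> complex vec) \<Rightarrow> bool" where
  "tight_frame_for d W \<beta> f \<longleftrightarrow>
     VectorSpace.subspace class_ring W (module_vec TYPE(complex) d) \<and>
     finite \<beta> \<and> (\<forall>j\<in>\<beta>. f j \<in> W) \<and>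
     (\<exists>A::real. A > 0 \<and>
        (\<forall>x\<in>W. (\<Sum>j\<in>\<beta>. complex_of_real ((cmod (x \<bullet>c f j))\<^sup>2)) = complex_of_real A * (x \<bullet>c x)))"

definition ETF_for :: "nat \<Rightarrow> complex vec set \<Rightarrow> 'i set \<Rightarrow> ('i \<Rightarrow> complex vec) \<Rightarrow> bool" where
  "ETF_for d W \<beta> f \<longleftrightarrow>
     tight_frame_for d W \<beta> f \<and>
     (\<exists>r. \<forall>j\<in>\<beta>. f j \<bullet>c f j = r) \<and>
     (\<exists>\<mu>. \<forall>i\<in>\<beta>. \<forall>j\<in>\<beta>. i \<noteq> j \<longrightarrow> cmod (f i \<bullet>c f j) = \<mu>)"

definition subspace_dim :: "nat \<Rightarrow> complex vec set \<Rightarrow> nat" where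
  "subspace_dim d W =
     vectorspace.dim class_ring (module_vec TYPE(complex) d\<lparr>carrier := W\<rparr>)"

definition unitary_mat :: "nat \<Rightarrow> complex mat \<Rightarrow> bool" where
  "unitary_mat d U \<longleftrightarrow>
     U \<in> carrier_mat d d \<and> mat_adjoint U * U = 1\<^sub>m d \<and> U * mat_adjoint U = 1\<^sub>m d"

text \<open>
  The equation \<open>\<Psi> = U \<Phi> P D\<close>, read column by column: \<open>\<Phi>\<close> and \<open>\<Psi>\<close> are the synthesis matrices,
  with columns \<open>f j\<close> and \<open>g j\<close>, \<open>j \<in> \<beta>\<close>; column \<open>j\<close> of \<open>P\<close> is the standard basis vector with
  index \<open>\<sigma> j\<close>, and \<open>\<delta> j\<close> is the \<open>j\<close>-th diagonal entry of \<open>D\<close>.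
\<close>

definition switching_equivalent ::
  "nat \<Rightarrow> 'i set \<Rightarrow> ('i \<Rightarrow> complex vec) \<Rightarrow> ('i \<Rightarrow> complex vec) \<Rightarrow> bool" where
  "switching_equivalent d \<beta> f g \<longleftrightarrow>
     (\<exists>U \<sigma> \<delta>. unitary_mat d U \<and> \<sigma> permutes \<beta> \<and> (\<forall>j\<in>\<beta>. cmod (\<delta> j) = 1) \<and>
        (\<forall>j\<in>\<beta>. g j = \<delta> j \<cdot>\<^sub>v (U *\<^sub>v f (\<sigma> j))))"

text \<open>
  The condition on the dimension is written additively, so that truncated subtraction does not
  admit \<open>\<beta> = {}\<close> (which would need a space of dimension \<open>-1\<close>).
\<close>

definition is_simplex :: "nat \<Rightarrow> ('i \<Rightarrow> complex vec) \<Rightarrow> 'i set \<Rightarrow> bool" where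
  "is_simplex d f \<beta> \<longleftrightarrow>
     (\<exists>W g. switching_equivalent d \<beta> f g \<and>
        ETF_for d W \<beta> g \<and> subspace_dim d W + 1 = card \<beta> \<and>
        (\<forall>i\<in>\<beta>. \<forall>j\<in>\<beta>. i \<noteq> j \<longrightarrow> g i \<bullet>c g j \<in> \<real> \<and> Re (g i \<bullet>c g j) < 0))"

definition simplex_binder :: "nat \<Rightarrow> ('i \<Rightarrow> complex vec) \<Rightarrow> 'i set set" where
  "simplex_binder d f = {\<beta>. is_simplex d f \<beta>}"


section \<open>The frame \<open>\<G>((p,p))\<close>\<close>

text \<open>
  The prime \<open>p\<close> is \<open>CARD('p)\<close> for a type \<open>'p\<close> of class \<open>prime_card\<close>, and
  \<open>'p mod_ring\<close> is the field of integers modulo \<open>p\<close>; its elements are ordered by their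
  representatives in \<open>{0..<p}\<close>.
\<close>

type_synonym 'p grp = "'p mod_ring \<times> 'p mod_ring"

definition rep :: "'p::prime_card mod_ring \<Rightarrow> nat" where
  "rep x = nat (to_int_mod_ring x)"

definition lex_less :: "'p::prime_card grp \<Rightarrow> 'p grp \<Rightarrow> bool" where
  "lex_less i j \<longleftrightarrow> rep (fst i) < rep (fst j) \<or> (fst i = fst j \<and> rep (snd i) < rep (snd j))"

definition lex_list :: "'p::prime_card grp list" where
  "lex_list = [(of_nat a, of_nat b). a \<leftarrow> [0..<CARD('p)], b \<leftarrow> [0..<CARD('p)]]"

text \<open>The coordinates of \<open>\<complex>\<^bsup>p\<^sup>2\<^esup>\<close> are numbered by the group in lexicographic order.\<close>

definition basis_vec :: "'p::prime_card grp \<Rightarrow> complex vec" where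
  "basis_vec j = unit_vec (CARD('p)\<^sup>2) (rep (fst j) * CARD('p) + rep (snd j))"

definition translation :: "'p::prime_card grp \<Rightarrow> complex mat" where
  "translation k = mat_of_cols (CARD('p)\<^sup>2) (map (\<lambda>j. basis_vec (j + k)) lex_list)"

definition modulation :: "complex \<Rightarrow> 'p::prime_card grp \<Rightarrow> complex mat" where
  "modulation \<zeta> \<kappa> = mat_of_cols (CARD('p)\<^sup>2)
     (map (\<lambda>j. \<zeta> ^ rep (fst \<kappa> * fst j + snd \<kappa> * snd j) \<cdot>\<^sub>v basis_vec j) lex_list)"

definition center :: "'p::prime_card grp" where
  "center = (of_nat ((CARD('p) - 1) div 2), of_nat ((CARD('p) - 1) div 2))"

definition phi :: "'p::prime_card grp \<Rightarrow> complex vec" where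
  "phi i = basis_vec i - basis_vec (- i - (1, 1))"

definition fiducial :: "'p::prime_card itself \<Rightarrow> complex vec" where
  "fiducial _ = vec_of_list (concat
     (map (\<lambda>i. list_of_vec (phi i)) (filter (\<lambda>i. lex_less i center) (lex_list :: 'p grp list))))"

definition kronecker :: "complex mat \<Rightarrow> complex mat \<Rightarrow> complex mat" where
  "kronecker A B = mat (dim_row A * dim_row B) (dim_col A * dim_col B)
     (\<lambda>(i, j). A $$ (i div dim_row B, j div dim_col B) * B $$ (i mod dim_row B, j mod dim_col B))"

definition gs_rep :: "complex \<Rightarrow> 'p::prime_card grp \<Rightarrow> 'p grp \<Rightarrow> complex mat" where
  "gs_rep \<zeta> k \<kappa> = kronecker (1\<^sub>m ((CARD('p)\<^sup>2 - 1) div 2)) (modulation \<zeta> \<kappa> * translation k)"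

definition gs_dim :: "'p::prime_card itself \<Rightarrow> nat" where
  "gs_dim _ = CARD('p)\<^sup>2 * (CARD('p)\<^sup>2 - 1) div 2"

definition gs_frame :: "complex \<Rightarrow> 'p::prime_card grp \<times> 'p grp \<Rightarrow> complex vec" where
  "gs_frame \<zeta> = (\<lambda>(k, \<kappa>). gs_rep \<zeta> k \<kappa> *\<^sub>v fiducial TYPE('p))"

definition primitive_root_of_unity :: "nat \<Rightarrow> complex \<Rightarrow> bool" where
  "primitive_root_of_unity n \<zeta> \<longleftrightarrow> n > 0 \<and> \<zeta> ^ n = 1 \<and> (\<forall>m. 0 < m \<and> m < n \<longrightarrow> \<zeta> ^ m \<noteq> 1)"


section \<open>The blocks\<close>

definition B0 :: "('p::prime_card grp \<times> 'p grp) set set" where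
  "B0 = {{(k, \<kappa>) | \<kappa>. True} | k. True}"

text \<open>The symmetric matrix \<open>A\<close> has rows \<open>(r, s)\<close> and \<open>(s, t)\<close>.\<close>

definition B1 :: "('p::prime_card grp \<times> 'p grp) set set" where
  "B1 = {{((k\<^sub>0, k\<^sub>1), (r * k\<^sub>0 + s * k\<^sub>1, s * k\<^sub>0 + t * k\<^sub>1) + b) | k\<^sub>0 k\<^sub>1. True} | r s t b. True}"

definition B2 :: "('p::prime_card grp \<times> 'p grp) set set" where
  "B2 = {{((c\<^sub>0, k\<^sub>1), (\<kappa>\<^sub>0, a * k\<^sub>1 + b)) | k\<^sub>1 \<kappa>\<^sub>0. True} | a b c\<^sub>0. True}"

definition B3 :: "('p::prime_card grp \<times> 'p grp) set set" where
  "B3 = {{((k\<^sub>0, c\<^sub>1), (a * k\<^sub>0 + b, \<kappa>\<^sub>1)) | k\<^sub>0 \<kappa>\<^sub>1. True} | a b c\<^sub>1. True}"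

definition B4 :: "('p::prime_card grp \<times> 'p grp) set set" where
  "B4 = {{((k\<^sub>0, \<alpha> * k\<^sub>0 + \<beta>), (\<kappa>\<^sub>0, (- 1 / \<alpha>) * \<kappa>\<^sub>0 + a * k\<^sub>0 + b)) | k\<^sub>0 \<kappa>\<^sub>0. True}
          | \<alpha> \<beta> a b. \<alpha> \<noteq> 0}"

definition AG_tilde :: "('p::prime_card grp \<times> 'p grp) set set" where
  "AG_tilde = B0 \<union> B1 \<union> B2 \<union> B3 \<union> B4"

end

theory Submission
  imports Defs
begin

text \<open>
  Let \<open>R\<close> be the involution \<open>e\<^sub>j \<mapsto> e\<^bsub>-j-(1,1)\<^esub>\<close>. Since \<open>\<Sum>\<^sub>i \<phi>\<^sub>i \<phi>\<^sub>i\<^sup>* = I - R\<close>, the inner product of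
  the frame vectors \<open>x = (k, \<kappa>)\<close> and \<open>y = (l, \<nu>)\<close> is \<open>p\<^sup>2 [x = y] - \<zeta>\<^sup>u\<close> with
  \<open>u = (\<kappa> - \<nu>) \<cdot> (k + l - (1,1)) / 2\<close>. If a set of vectors is a simplex, then after switching its
  Gram matrix is \<open>p\<^sup>2 I - J\<close>, and this is singular only for \<open>p\<^sup>2\<close> vectors. Hence a set is a simplex
  if and only if it has \<open>p\<^sup>2\<close> elements and \<open>u\<close> is a coboundary on it, that is, the sums of \<open>u\<close> over
  all triangles \<open>x, y, z\<close> vanish. Twice such a sum is \<open>[x - z, y - z]\<close> for the standard symplectic
  form, so the simplices are the affine Lagrangian planes of \<open>\<int>\<^sub>p\<^sup>4\<close>. These are classified by the
  rank of their projection to the coordinates \<open>(k\<^sub>0, k\<^sub>1)\<close>: rank 0 gives \<open>\<B>\<^sub>0\<close>, rank 2 gives \<open>\<B>\<^sub>1\<close>,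
  and rank 1 gives \<open>\<B>\<^sub>2\<close>, \<open>\<B>\<^sub>3\<close> or \<open>\<B>\<^sub>4\<close> according to the direction of the image.
\<close>

section \<open>Affine Lagrangian planes\<close>

text \<open>With \<open>x = (k, \<kappa>)\<close> and \<open>y = (l, \<nu>)\<close> this is
  \<open>\<kappa> \<cdot> l - \<nu> \<cdot> k\<close>, the standard symplectic form.\<close>

definition symp :: "'p::prime_card grp \<times> 'p grp \<Rightarrow> 'p grp \<times> 'p grp \<Rightarrow> 'p mod_ring" where
  "symp x y = fst (snd x) * fst (fst y) + snd (snd x) * snd (fst y)
            - fst (snd y) * fst (fst x) - snd (snd y) * snd (fst x)"

text \<open>Treats \<open>B1\<close> to \<open>B4\<close> uniformly: each of their members is
  parametrized injectively by two scalars.\<close>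

lemma card_param_block:
  fixes f :: "'p::prime_card mod_ring \<Rightarrow> 'p mod_ring \<Rightarrow> 'c"
  assumes "\<And>a b a' b'. f a b = f a' b' \<Longrightarrow> a = a' \<and> b = b'"
  shows "card {f a b | a b. True} = CARD('p)\<^sup>2"
proof -
  have "{f a b | a b. True} = case_prod f ` UNIV"
    by force
  moreover have "inj (case_prod f)"
    using assms by (auto simp: inj_def)
  ultimately show ?thesis
    by (simp add: card_image power2_eq_square)
qed

lemma card_AG_tilde:
  fixes L :: "('p::prime_card grp \<times> 'p grp) set"
  assumes "L \<in> AG_tilde"
  shows "card L = CARD('p)\<^sup>2"
proof -
  have "card L = CARD('p)\<^sup>2" if L: "L \<in> B0"
  proof -
    obtain k0 k1 where "L = {((k0, k1), \<kappa>) | \<kappa>. True}" using L by (auto simp: B0_def)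
    then have "L = Pair (k0, k1) ` UNIV" by auto
    then show ?thesis by (simp add: card_image inj_on_def power2_eq_square)
  qed
  moreover have "card L = CARD('p)\<^sup>2" if "L \<in> B1 \<union> B2 \<union> B3 \<union> B4"
    using that unfolding B1_def B2_def B3_def B4_def
    by (elim UnE CollectE exE conjE; simp only:; intro card_param_block; simp)
  ultimately show ?thesis using assms unfolding AG_tilde_def by blast
qed

text \<open>Reduces membership in \<open>AG_tilde\<close> to containment in a block, since all
  blocks have the same finite size.\<close>

lemma AG_tilde_superset:
  fixes S L :: "('p::prime_card grp \<times> 'p grp) set"
  assumes "L \<in> AG_tilde" "S \<subseteq> L" "card S = CARD('p)\<^sup>2"
  shows "S \<in> AG_tilde"
proof -
  have "finite L" by simp
  then have "S = L"
    using assms card_AG_tilde by (metis card_subset_eq)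
  with assms show ?thesis by simp
qed

text \<open>Differences of points remove the offsets. What is left cancels by symmetry of the matrix
  in \<open>B1\<close>, and in \<open>B4\<close> because the slopes \<open>\<alpha>\<close> and
  \<open>- 1 / \<alpha>\<close> make the free frequency direction orthogonal to the position
  direction.\<close>

lemma AG_tilde_isotropic:
  fixes L :: "('p::prime_card grp \<times> 'p grp) set"
  assumes "L \<in> AG_tilde" "x \<in> L" "y \<in> L" "z \<in> L"
  shows "symp (x - z) (y - z) = 0"
  using assms unfolding AG_tilde_def B0_def B1_def B2_def B3_def B4_def
  by (elim UnE; clarsimp simp: symp_def field_simps)

text \<open>\<open>S\<close> is not assumed to be closed under any operation. Isotropy of the
  differences from one base point \<open>z\<close> already confines \<open>S\<close> to a block, and
  the cardinality then forces equality.\<close>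

lemma isotropic_in_AG_tilde:
  fixes S :: "('p::prime_card grp \<times> 'p grp) set"
  assumes card: "card S = CARD('p)\<^sup>2"
    and iso: "\<And>x y z. \<lbrakk>x \<in> S; y \<in> S; z \<in> S\<rbrakk> \<Longrightarrow> symp (x - z) (y - z) = 0"
  shows "S \<in> AG_tilde"
proof -
  have "S \<noteq> {}" using card by auto
  then obtain z where z: "z \<in> S" by blast
  obtain z0 z1 w0 w1 where zeq: "z = ((z0, z1), (w0, w1))" by (metis prod.collapse)
  define T where "T = (\<lambda>s. s - z) ` S"
  have Tiso: "symp x y = 0" if "x \<in> T" "y \<in> T" for x y
    using that iso[OF _ _ z] unfolding T_def by blast
  have S_T: "\<exists>k0 k1 l0 l1. ((k0, k1), (l0, l1)) \<in> T \<and> s = ((k0 + z0, k1 + z1), (l0 + w0, l1 + w1))"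
    if "s \<in> S" for s
  proof -
    obtain a b c d where "s = ((a, b), (c, d))" by (metis prod.collapse)
    then have "((a - z0, b - z1), (c - w0, d - w1)) \<in> T"
      using that unfolding T_def image_iff zeq by (intro bexI[of _ s]) auto
    with \<open>s = _\<close> show ?thesis
      by (intro exI[of _ "a - z0"] exI[of _ "b - z1"] exI[of _ "c - w0"] exI[of _ "d - w1"]) auto
  qed
  have "\<exists>L \<in> AG_tilde. S \<subseteq> L"
  \<comment> \<open>A nonzero determinant of two positions means that the projection to positions
    has rank 2.\<close>
  proof (cases "\<exists>x y. x \<in> T \<and> y \<in> T \<and> fst (fst x) * snd (fst y) \<noteq> snd (fst x) * fst (fst y)")
    case True
    then obtain x0 x1 a0 a1 y0 y1 b0 b1 where
      x: "((x0, x1), (a0, a1)) \<in> T" and y: "((y0, y1), (b0, b1)) \<in> T" and ne: "x0 * y1 \<noteq> x1 * y0"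
      by force
    define D where "D = x0 * y1 - x1 * y0"
    have D: "D \<noteq> 0" using ne by (simp add: D_def)
    have xy: "a0 * y0 + a1 * y1 = b0 * x0 + b1 * x1"
      using Tiso[OF x y] by (simp add: symp_def algebra_simps)
    \<comment> \<open>Cramer's rule for the matrix that sends the position of \<open>x\<close> to
      \<open>(a0, a1)\<close> and that of \<open>y\<close> to \<open>(b0, b1)\<close>. Here
      \<open>s\<close> is computed from the second row.\<close>
    define r s t where "r = (a0 * y1 - b0 * x1) / D" and "s = (a1 * y1 - b1 * x1) / D"
      and "t = (x0 * b1 - y0 * a1) / D"
    \<comment> \<open>The first row yields this other formula for the off-diagonal entry. Isotropy
      of the pair \<open>x\<close>, \<open>y\<close> makes both agree, which is the symmetry of the
      matrix.\<close>
    have s: "s = (x0 * b0 - y0 * a0) / D"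
      using xy by (simp add: s_def algebra_simps)
    have T: "l0 = r * k0 + s * k1 \<and> l1 = s * k0 + t * k1" if "((k0, k1), (l0, l1)) \<in> T" for k0 k1 l0 l1
    proof -
      \<comment> \<open>Isotropy against \<open>x\<close> and \<open>y\<close> is a linear system
        for \<open>(l0, l1)\<close> with determinant \<open>D\<close>, so the position determines
        the frequency.\<close>
      have e1: "a0 * k0 + a1 * k1 = l0 * x0 + l1 * x1" and e2: "b0 * k0 + b1 * k1 = l0 * y0 + l1 * y1"
        using Tiso[OF x that] Tiso[OF y that] by (simp_all add: symp_def algebra_simps)
      have "l0 * D = (a0 * k0 + a1 * k1) * y1 - (b0 * k0 + b1 * k1) * x1"
        unfolding e1 e2 D_def by (simp add: algebra_simps)
      moreover have "l1 * D = (b0 * k0 + b1 * k1) * x0 - (a0 * k0 + a1 * k1) * y0"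
        unfolding e1 e2 D_def by (simp add: algebra_simps)
      ultimately have "l0 = ((a0 * k0 + a1 * k1) * y1 - (b0 * k0 + b1 * k1) * x1) / D"
        "l1 = ((b0 * k0 + b1 * k1) * x0 - (a0 * k0 + a1 * k1) * y0) / D"
        using D by (metis nonzero_eq_divide_eq)+
      moreover have "r * k0 + s * k1 = ((a0 * k0 + a1 * k1) * y1 - (b0 * k0 + b1 * k1) * x1) / D"
        unfolding r_def s_def using D by (simp add: field_simps)
      moreover have "s * k0 + t * k1 = ((b0 * k0 + b1 * k1) * x0 - (a0 * k0 + a1 * k1) * y0) / D"
        unfolding s t_def using D by (simp add: field_simps)
      ultimately show ?thesis by simp
    qed
    \<comment> \<open>The offset for which the block passes through the base point
      \<open>z\<close>.\<close>
    define b where "b = (w0 - (r * z0 + s * z1), w1 - (s * z0 + t * z1))"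
    define L where "L = {((k0, k1), (r * k0 + s * k1, s * k0 + t * k1) + b) | k0 k1. True}"
    have "L \<in> B1" unfolding B1_def L_def by blast
    moreover have "S \<subseteq> L"
    proof
      fix u assume "u \<in> S"
      from S_T[OF this] obtain k0 k1 l0 l1 where
        k: "((k0, k1), (l0, l1)) \<in> T" and u: "u = ((k0 + z0, k1 + z1), (l0 + w0, l1 + w1))" by blast
      show "u \<in> L"
        unfolding u L_def b_def mem_Collect_eq
        by (rule exI[of _ "k0 + z0"], rule exI[of _ "k1 + z1"]) (simp add: T[OF k] algebra_simps)
    qed
    ultimately show ?thesis unfolding AG_tilde_def by blast
  next
    case False
    show ?thesis
    proof (cases "\<forall>x\<in>T. fst x = 0")
      case True
      have "S \<subseteq> {((z0, z1), \<kappa>) | \<kappa>. True}"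
      proof
        fix u assume "u \<in> S"
        from S_T[OF this] True show "u \<in> {((z0, z1), \<kappa>) | \<kappa>. True}"
          by (force simp: zero_prod_def)
      qed
      moreover have "{((z0, z1), \<kappa>) | \<kappa>. True} \<in> B0" unfolding B0_def by blast
      ultimately show ?thesis unfolding AG_tilde_def by blast
    next
      case nz: False
      then obtain x0 x1 a0 a1 where x: "((x0, x1), (a0, a1)) \<in> T" and x_nz: "x0 \<noteq> 0 \<or> x1 \<noteq> 0"
        by (force simp: zero_prod_def)
      \<comment> \<open>The rank is at most 1, so every position is parallel to the nonzero
        \<open>(x0, x1)\<close>.\<close>
      have par: "x0 * k1 = x1 * k0" if "((k0, k1), (l0, l1)) \<in> T" for k0 k1 l0 l1
        using False x that by force
      have e: "a0 * k0 + a1 * k1 = l0 * x0 + l1 * x1" if "((k0, k1), (l0, l1)) \<in> T" for k0 k1 l0 l1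
        using Tiso[OF x that] by (simp add: symp_def algebra_simps)
      \<comment> \<open>A direction along the second axis leads to \<open>B2\<close>, along the
        first axis to \<open>B3\<close>, and any other to \<open>B4\<close>.\<close>
      consider "x0 = 0" "x1 \<noteq> 0" | "x1 = 0" "x0 \<noteq> 0" | "x0 \<noteq> 0" "x1 \<noteq> 0" using x_nz by blast
      then show ?thesis
      proof cases
        case 1
        \<comment> \<open>Isotropy against \<open>x\<close> involves only the second coordinates
          here and reads \<open>l1 * x1 = a1 * k1\<close>; the first frequency stays free.\<close>
        define q where "q = a1 / x1"
        define L :: "('p grp \<times> 'p grp) set"
          where "L = {((z0, k1), (l0, q * k1 + (w1 - q * z1))) | k1 l0. True}"
        have "S \<subseteq> L"
        proof
          fix u assume "u \<in> S"
          from S_T[OF this] obtain k0 k1 l0 l1 where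
            k: "((k0, k1), (l0, l1)) \<in> T" and u: "u = ((k0 + z0, k1 + z1), (l0 + w0, l1 + w1))" by blast
          have k0: "k0 = 0" using par[OF k] 1 by simp
          have "l1 * x1 = a1 * k1" using e[OF k] 1 k0 by simp
          then have l1: "l1 = q * k1"
            using 1 by (metis q_def nonzero_eq_divide_eq times_divide_eq_left)
          show "u \<in> L"
            unfolding u L_def mem_Collect_eq k0 l1
            by (rule exI[of _ "k1 + z1"], rule exI[of _ "l0 + w0"]) (simp add: algebra_simps)
        qed
        moreover have "L \<in> B2" unfolding B2_def L_def by blast
        ultimately show ?thesis unfolding AG_tilde_def by blast
      next
        case 2
        define q where "q = a0 / x0"
        define L :: "('p grp \<times> 'p grp) set"
          where "L = {((k0, z1), (q * k0 + (w0 - q * z0), l1)) | k0 l1. True}"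
        have "S \<subseteq> L"
        proof
          fix u assume "u \<in> S"
          from S_T[OF this] obtain k0 k1 l0 l1 where
            k: "((k0, k1), (l0, l1)) \<in> T" and u: "u = ((k0 + z0, k1 + z1), (l0 + w0, l1 + w1))" by blast
          have k1: "k1 = 0" using par[OF k] 2 by simp
          have "l0 * x0 = a0 * k0" using e[OF k] 2 k1 by simp
          then have l0: "l0 = q * k0"
            using 2 by (metis q_def nonzero_eq_divide_eq times_divide_eq_left)
          show "u \<in> L"
            unfolding u L_def mem_Collect_eq k1 l0
            by (rule exI[of _ "k0 + z0"], rule exI[of _ "l1 + w1"]) (simp add: algebra_simps)
        qed
        moreover have "L \<in> B3" unfolding B3_def L_def by blast
        ultimately show ?thesis unfolding AG_tilde_def by blast
      next
        case 3
        \<comment> \<open>\<open>\<alpha>\<close> is the slope of the common direction. Isotropy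
          against \<open>x\<close> becomes
          \<open>l1 * x1 = (a0 + a1 * \<alpha>) * k0 - l0 * x0\<close>; dividing by
          \<open>x1\<close> gives \<open>a\<close> and the coefficient \<open>- 1 / \<alpha>\<close>
          of \<open>l0\<close>.\<close>
        define \<alpha> a where "\<alpha> = x1 / x0" and "a = (a0 + a1 * \<alpha>) / x1"
        have \<alpha>: "\<alpha> \<noteq> 0" using 3 by (simp add: \<alpha>_def)
        \<comment> \<open>Both offsets are fixed by requiring that \<open>z\<close> lies on the
          block.\<close>
        define \<beta> b where "\<beta> = z1 - \<alpha> * z0" and "b = w1 + 1 / \<alpha> * w0 - a * z0"
        define L where "L = {((k0, \<alpha> * k0 + \<beta>), (l0, (- 1 / \<alpha>) * l0 + a * k0 + b)) | k0 l0. True}"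
        have "S \<subseteq> L"
        proof
          fix u assume "u \<in> S"
          from S_T[OF this] obtain k0 k1 l0 l1 where
            k: "((k0, k1), (l0, l1)) \<in> T" and u: "u = ((k0 + z0, k1 + z1), (l0 + w0, l1 + w1))" by blast
          have k1: "k1 = \<alpha> * k0"
            using par[OF k] 3 by (simp add: \<alpha>_def field_simps)
          have "l1 * x1 = (a0 + a1 * \<alpha>) * k0 - l0 * x0"
            using e[OF k] unfolding k1 by (simp add: algebra_simps)
          then have "l1 = ((a0 + a1 * \<alpha>) * k0 - l0 * x0) / x1"
            using 3 by (metis nonzero_eq_divide_eq)
          then have l1: "l1 = a * k0 - 1 / \<alpha> * l0"
            by (simp add: a_def \<alpha>_def diff_divide_distrib)
          show "u \<in> L"
            unfolding u L_def mem_Collect_eq k1 l1 \<beta>_def b_def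
            by (rule exI[of _ "k0 + z0"], rule exI[of _ "l0 + w0"]) (simp add: algebra_simps add_divide_distrib)
        qed
        moreover have "L \<in> B4" unfolding B4_def L_def using \<alpha> by blast
        ultimately show ?thesis unfolding AG_tilde_def by blast
      qed
    qed
  qed
  then show ?thesis using AG_tilde_superset card by blast
qed

section \<open>Simplices and Gram matrices\<close>

text \<open>Independence and span inside the subspace agree with those in the ambient space, so a
  basis of \<open>W\<close> can be checked there.\<close>

lemma dim_eq_card_basis:
  assumes sub: "VectorSpace.subspace class_ring W (module_vec TYPE(complex) d)"
    and A: "finite A" "A \<subseteq> W"
    and li: "LinearCombinations.module.lin_indpt class_ring (module_vec TYPE(complex) d) A"
    and gen: "W \<subseteq> LinearCombinations.module.span class_ring (module_vec TYPE(complex) d) A"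
  shows "subspace_dim d W = card A"
proof -
  interpret vec_space "TYPE(complex)" d .
  have sm: "submodule class_ring W V" using sub by (simp add: subspace_def)
  interpret W: vectorspace class_ring "vs W" using sub by (rule subspace_is_vs)
  have "W.span A \<subseteq> W"
    using W.span_is_subset2[of A] A by simp
  with gen have "W.basis A"
    unfolding W.basis_def using span_li_not_depend[OF A(2) sm] li A by auto
  then show ?thesis
    unfolding subspace_dim_def using W.dim_basis A by simp
qed

text \<open>Finite dimension of \<open>W\<close> has to be established first: independent subsets of
  \<open>W\<close> are independent in the ambient space, hence have at most \<open>d\<close>
  elements, and a maximal one is a basis.\<close>

lemma li_card_le_subspace_dim:
  assumes sub: "VectorSpace.subspace class_ring W (module_vec TYPE(complex) d)"
    and A: "finite A" "A \<subseteq> W"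
    and li: "LinearCombinations.module.lin_indpt class_ring (module_vec TYPE(complex) d) A"
  shows "card A \<le> subspace_dim d W"
proof -
  interpret vec_space "TYPE(complex)" d .
  have sm: "submodule class_ring W V" using sub by (simp add: subspace_def)
  have WV: "W \<subseteq> carrier V" using sm by (rule submodule.subset)
  interpret W: vectorspace class_ring "vs W" using sub by (rule subspace_is_vs)
  have bd: "finite S \<and> card S \<le> d" if "S \<subseteq> W \<and> W.lin_indpt S" for S
  proof -
    have "lin_indpt S" using that span_li_not_depend(2)[OF _ sm, of S] by simp
    then show ?thesis using li_le_dim[of S] that WV dim_is_n by auto
  qed
  have "W.lin_indpt A" using li span_li_not_depend(2)[OF A(2) sm] by simp
  then have "\<exists>B. finite B \<and> maximal B (\<lambda>S. S \<subseteq> W \<and> W.lin_indpt S)"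
    using A by (intro maximal_exists[where N = d and B = A]) (use bd in auto)
  then obtain B where "finite B" "W.basis B"
    using W.max_li_is_basis by auto
  then have "W.fin_dim"
    unfolding W.fin_dim_def W.basis_def by auto
  then show ?thesis
    unfolding subspace_dim_def using W.li_le_dim(2)[of A] \<open>W.lin_indpt A\<close> A by simp
qed

lemma cscalar_prod_lincomb:
  assumes "A \<subseteq> carrier_vec d" "w \<in> carrier_vec d"
  shows "LinearCombinations.module.lincomb (module_vec TYPE(complex) d) a A \<bullet>c w = (\<Sum>v\<in>A. a v * (v \<bullet>c w))"
proof -
  interpret vec_space "TYPE(complex)" d .
  show ?thesis
    unfolding lincomb_def using assms
    by (subst finsum_scalar_prod_sum) (auto intro!: sum.cong)
qed

text \<open>The Gram matrix of \<open>A\<close> is \<open>N I - J\<close>, whose only zero eigenvalue occurs for \<open>card A = N\<close>.\<close>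

lemma lin_indpt_simplex_gram:
  fixes N :: nat
  assumes A: "finite A" "A \<subseteq> carrier_vec d" "card A \<noteq> N" "N > 0"
    and gram: "\<And>v w. \<lbrakk>v \<in> A; w \<in> A\<rbrakk> \<Longrightarrow> v \<bullet>c w = (if v = w then of_nat N else 0) - (1 :: complex)"
  shows "LinearCombinations.module.lin_indpt class_ring (module_vec TYPE(complex) d) A"
proof -
  interpret vec_space "TYPE(complex)" d .
  show ?thesis
  proof (rule finite_lin_indpt2)
    fix a assume 0: "lincomb a A = 0\<^sub>v d"
    \<comment> \<open>Pairing a linear relation with \<open>w\<close> shows that every coefficient
      is the total of the coefficients divided by \<open>N\<close>.\<close>
    have *: "of_nat N * a w = (\<Sum>v\<in>A. a v)" if "w \<in> A" for w
    proof -
      have w: "w \<in> carrier_vec d" using that A by auto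
      have "0 = lincomb a A \<bullet>c w" using 0 w by simp
      also have "\<dots> = (\<Sum>v\<in>A. a v * (v \<bullet>c w))" using A w by (simp add: cscalar_prod_lincomb)
      also have "\<dots> = (\<Sum>v\<in>A. (if v = w then of_nat N * a v else 0) - a v)"
        by (intro sum.cong) (simp_all add: gram that algebra_simps)
      also have "\<dots> = of_nat N * a w - (\<Sum>v\<in>A. a v)"
        using A that by (simp add: sum_subtractf)
      finally show ?thesis by simp
    qed
    \<comment> \<open>Summing over \<open>w\<close> makes \<open>N - card A\<close> times the total
      vanish. As \<open>card A \<noteq> N\<close>, the total is zero, and with it each
      coefficient.\<close>
    have "of_nat N * (\<Sum>w\<in>A. a w) = (\<Sum>w\<in>A. \<Sum>v\<in>A. a v)"
      unfolding sum_distrib_left by (intro sum.cong refl *)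
    then have "(of_nat N - of_nat (card A)) * (\<Sum>w\<in>A. a w) = 0"
      by (simp add: algebra_simps)
    then have "(\<Sum>w\<in>A. a w) = 0" using A by simp
    then show "\<forall>v\<in>A. a v = 0" using * A by simp
  qed (use A in auto)
qed

section \<open>Inner products under switching\<close>

lemma unitary_cscalar_prod:
  assumes U: "unitary_mat d U" and x: "x \<in> carrier_vec d" and y: "y \<in> carrier_vec d"
  shows "(U *\<^sub>v x) \<bullet>c (U *\<^sub>v y) = x \<bullet>c y"
proof -
  have Uc: "U \<in> carrier_mat d d" and UU: "mat_adjoint U * U = 1\<^sub>m d"
    using U by (auto simp: unitary_mat_def)
  have adj: "mat_adjoint U $$ (i, j) = cnj (U $$ (j, i))" if "i < d" "j < d" for i j
    using that Uc unfolding mat_adjoint_def by (auto simp: mat_of_rows_def)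
  have adjc: "mat_adjoint U \<in> carrier_mat d d"
    using Uc unfolding mat_adjoint_def by auto
  have "(U *\<^sub>v x) \<bullet>c (U *\<^sub>v y) = (\<Sum>r<d. (\<Sum>i<d. U $$ (r, i) * x $ i) * cnj (\<Sum>j<d. U $$ (r, j) * y $ j))"
    using Uc x y by (auto simp: scalar_prod_def lessThan_atLeast0 intro!: sum.cong)
  also have "\<dots> = (\<Sum>r<d. \<Sum>i<d. \<Sum>j<d. x $ i * cnj (y $ j) * (cnj (U $$ (r, j)) * U $$ (r, i)))"
    by (simp add: sum_product algebra_simps)
  also have "\<dots> = (\<Sum>i<d. \<Sum>r<d. \<Sum>j<d. x $ i * cnj (y $ j) * (cnj (U $$ (r, j)) * U $$ (r, i)))"
    by (rule sum.swap)
  also have "\<dots> = (\<Sum>i<d. \<Sum>j<d. \<Sum>r<d. x $ i * cnj (y $ j) * (cnj (U $$ (r, j)) * U $$ (r, i)))"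
    by (intro sum.cong refl sum.swap)
  also have "\<dots> = (\<Sum>i<d. \<Sum>j<d. x $ i * cnj (y $ j) * (if j = i then 1 else 0))"
  proof (intro sum.cong refl)
    fix i j assume ij: "i \<in> {..<d}" "j \<in> {..<d}"
    have "(\<Sum>r<d. cnj (U $$ (r, j)) * U $$ (r, i)) = (mat_adjoint U * U) $$ (j, i)"
      using ij Uc adjc by (auto simp: scalar_prod_def lessThan_atLeast0 adj intro!: sum.cong)
    then show "(\<Sum>r<d. x $ i * cnj (y $ j) * (cnj (U $$ (r, j)) * U $$ (r, i)))
        = x $ i * cnj (y $ j) * (if j = i then 1 else 0)"
      using ij unfolding UU by (simp flip: sum_distrib_left)
  qed
  also have "\<dots> = x \<bullet>c y"
    using x y by (simp add: scalar_prod_def lessThan_atLeast0 if_distrib cong: if_cong)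
  finally show ?thesis .
qed


lemma cscalar_prod_commute:
  assumes "x \<in> carrier_vec d" "y \<in> carrier_vec d"
  shows "y \<bullet>c x = cnj (x \<bullet>c (y :: complex vec))"
  using assms by (auto simp: scalar_prod_def intro!: sum.cong)

lemma switching_cscalar_prod:
  assumes "\<And>j. j \<in> \<beta> \<Longrightarrow> g j = \<delta> j \<cdot>\<^sub>v (U *\<^sub>v f (\<sigma> j))"
    and "unitary_mat d U" "\<sigma> permutes \<beta>" "\<And>j. j \<in> \<beta> \<Longrightarrow> f j \<in> carrier_vec d"
    and "i \<in> \<beta>" "j \<in> \<beta>"
  shows "g i \<bullet>c g j = \<delta> i * cnj (\<delta> j) * (f (\<sigma> i) \<bullet>c f (\<sigma> j))"
proof -
  have [simp]: "U \<in> carrier_mat d d" using assms by (simp add: unitary_mat_def)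
  have fc: "f (\<sigma> k) \<in> carrier_vec d" if "k \<in> \<beta>" for k
    using that assms permutes_in_image by metis
  have uf: "U *\<^sub>v f (\<sigma> k) \<in> carrier_vec d" if "k \<in> \<beta>" for k
    using fc[OF that] by (intro mult_mat_vec_carrier) auto
  have "g i \<bullet>c g j = \<delta> i * cnj (\<delta> j) * ((U *\<^sub>v f (\<sigma> i)) \<bullet>c (U *\<^sub>v f (\<sigma> j)))"
    using uf[of i] uf[of j] assms by (simp add: conjugate_smult_vec)
  then show ?thesis using unitary_cscalar_prod assms fc by simp
qed

text \<open>Extracts from a simplex its size and a trivialization of the Gram entries by phases. The
  unitary preserves inner products, and the permutation is absorbed into the choice of
  phases.\<close>

lemma is_simplex_imp_phases:
  fixes f :: "'i \<Rightarrow> complex vec" and N :: nat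
  assumes N: "N > 0"
    and fc: "\<And>x. x \<in> \<beta> \<Longrightarrow> f x \<in> carrier_vec d"
    and norm: "\<And>x. x \<in> \<beta> \<Longrightarrow> f x \<bullet>c f x = of_nat N - 1"
    and unimod: "\<And>x y. \<lbrakk>x \<in> \<beta>; y \<in> \<beta>; x \<noteq> y\<rbrakk> \<Longrightarrow> cmod (f x \<bullet>c f y) = 1"
    and simplex: "is_simplex d f \<beta>"
  shows "card \<beta> = N"
    and "\<exists>\<delta>. (\<forall>j\<in>\<beta>. cmod (\<delta> j) = 1) \<and>
          (\<forall>i\<in>\<beta>. \<forall>j\<in>\<beta>. i \<noteq> j \<longrightarrow> \<delta> i * cnj (\<delta> j) * (f i \<bullet>c f j) = -1)"
proof -
  obtain W g U \<sigma> \<delta> where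
    U: "unitary_mat d U" and \<sigma>: "\<sigma> permutes \<beta>" and \<delta>: "\<And>j. j \<in> \<beta> \<Longrightarrow> cmod (\<delta> j) = 1"
    and g: "\<And>j. j \<in> \<beta> \<Longrightarrow> g j = \<delta> j \<cdot>\<^sub>v (U *\<^sub>v f (\<sigma> j))"
    and etf: "ETF_for d W \<beta> g" and dimW: "subspace_dim d W + 1 = card \<beta>"
    and neg: "\<And>i j. \<lbrakk>i \<in> \<beta>; j \<in> \<beta>; i \<noteq> j\<rbrakk> \<Longrightarrow> g i \<bullet>c g j \<in> \<real> \<and> Re (g i \<bullet>c g j) < 0"
    using simplex unfolding is_simplex_def switching_equivalent_def by metis
  have \<sigma>_mem: "\<sigma> i \<in> \<beta>" if "i \<in> \<beta>" for i using that \<sigma> permutes_in_image by metis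
  have inner: "g i \<bullet>c g j = \<delta> i * cnj (\<delta> j) * (f (\<sigma> i) \<bullet>c f (\<sigma> j))" if "i \<in> \<beta>" "j \<in> \<beta>" for i j
    using switching_cscalar_prod[where \<beta> = \<beta> and f = f and g = g] g U \<sigma> fc that by blast
  \<comment> \<open>Switching keeps the modulus 1, and the only negative real of modulus 1 is
    \<open>-1\<close>.\<close>
  have off: "g i \<bullet>c g j = -1" if "i \<in> \<beta>" "j \<in> \<beta>" "i \<noteq> j" for i j
  proof -
    have "\<sigma> i \<noteq> \<sigma> j" using \<sigma> that permutes_inj by (metis injD)
    then have "cmod (g i \<bullet>c g j) = 1"
      using that by (simp add: inner norm_mult \<delta> unimod \<sigma>_mem)
    then show ?thesis using neg[OF that]
      by (auto simp: complex_is_Real_iff cmod_def complex_eq_iff power2_eq_1_iff)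
  qed
  have diag: "g i \<bullet>c g i = of_nat N - 1" if "i \<in> \<beta>" for i
    using that \<delta>[OF that] by (simp add: inner norm \<sigma>_mem complex_norm_square[symmetric])
  have "finite \<beta>" and sub: "VectorSpace.subspace class_ring W (module_vec TYPE(complex) d)"
    and gW: "\<And>j. j \<in> \<beta> \<Longrightarrow> g j \<in> W"
    using etf by (auto simp: ETF_for_def tight_frame_for_def)
  have "inj_on g \<beta>"
  proof (rule inj_onI, rule ccontr)
    fix i j assume ij: "i \<in> \<beta>" "j \<in> \<beta>" "g i = g j" "i \<noteq> j"
    then have "(of_nat N :: complex) - 1 = -1" using off[of i j] diag[of j] by simp
    then show False using N by simp
  qed
  show "card \<beta> = N"
  proof (rule ccontr)
    assume ne: "card \<beta> \<noteq> N"
    \<comment> \<open>If the size differed from \<open>N\<close>, there would be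
      \<open>card \<beta>\<close> independent vectors in a space of dimension
      \<open>card \<beta> - 1\<close>.\<close>
    have "LinearCombinations.module.lin_indpt class_ring (module_vec TYPE(complex) d) (g ` \<beta>)"
    proof (rule lin_indpt_simplex_gram[OF _ _ _ N])
      show "g ` \<beta> \<subseteq> carrier_vec d"
        using g fc \<sigma>_mem U by (auto simp: unitary_mat_def)
      show "card (g ` \<beta>) \<noteq> N" using ne \<open>inj_on g \<beta>\<close> by (simp add: card_image)
    qed (use \<open>finite \<beta>\<close> off diag in auto)
    then have "card (g ` \<beta>) \<le> subspace_dim d W"
      using sub gW \<open>finite \<beta>\<close> by (intro li_card_le_subspace_dim) auto
    then show False using dimW \<open>inj_on g \<beta>\<close> by (simp add: card_image)
  qed
  \<comment> \<open>Since the relation \<open>off\<close> holds for all pairs, reindexing by the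
    inverse permutation only relabels the phases.\<close>
  define \<tau> where "\<tau> = Hilbert_Choice.inv \<sigma>"
  have \<tau>: "\<tau> i \<in> \<beta>" "\<sigma> (\<tau> i) = i" if "i \<in> \<beta>" for i
    using that \<sigma> permutes_inv[OF \<sigma>] permutes_in_image permutes_inverses(1) unfolding \<tau>_def by metis+
  show "\<exists>\<delta>. (\<forall>j\<in>\<beta>. cmod (\<delta> j) = 1) \<and>
          (\<forall>i\<in>\<beta>. \<forall>j\<in>\<beta>. i \<noteq> j \<longrightarrow> \<delta> i * cnj (\<delta> j) * (f i \<bullet>c f j) = -1)"
  proof (intro exI[of _ "\<delta> \<circ> \<tau>"] conjI ballI impI)
    fix i j assume ij: "i \<in> \<beta>" "j \<in> \<beta>" "i \<noteq> j"
    then have "\<tau> i \<noteq> \<tau> j" using \<tau> by metis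
    then show "(\<delta> \<circ> \<tau>) i * cnj ((\<delta> \<circ> \<tau>) j) * (f i \<bullet>c f j) = -1"
      using off[of "\<tau> i" "\<tau> j"] inner[of "\<tau> i" "\<tau> j"] ij \<tau> by simp
  qed (use \<delta> \<tau> in auto)
qed

text \<open>
  The space is the image of the frame operator, written as its eigenspace for \<open>N\<close>; in this form
  tightness is immediate.
\<close>

lemma phases_imp_is_simplex:
  fixes f :: "'i \<Rightarrow> complex vec" and N :: nat
  assumes N: "N > 0" and finb: "finite \<beta>" and card: "card \<beta> = N"
    and fc: "\<And>x. x \<in> \<beta> \<Longrightarrow> f x \<in> carrier_vec d"
    and norm: "\<And>x. x \<in> \<beta> \<Longrightarrow> f x \<bullet>c f x = of_nat N - 1"
    and \<delta>: "\<And>j. j \<in> \<beta> \<Longrightarrow> cmod (\<delta> j) = 1"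
    and phases: "\<And>i j. \<lbrakk>i \<in> \<beta>; j \<in> \<beta>; i \<noteq> j\<rbrakk> \<Longrightarrow> \<delta> i * cnj (\<delta> j) * (f i \<bullet>c f j) = -1"
  shows "is_simplex d f \<beta>"
proof -
  interpret vec_space "TYPE(complex)" d .
  define g where "g j = \<delta> j \<cdot>\<^sub>v f j" for j
  have gc[simp]: "g j \<in> carrier_vec d" if "j \<in> \<beta>" for j using fc that by (simp add: g_def)
  have gdim[simp]: "dim_vec (g j) = d" if "j \<in> \<beta>" for j using gc[OF that] by auto
  have U: "unitary_mat d (1\<^sub>m d)"
  proof -
    have "mat_adjoint (1\<^sub>m d) = (1\<^sub>m d :: complex mat)"
      unfolding mat_adjoint_def by (rule eq_matI) (auto simp: mat_of_rows_def)
    then show ?thesis by (simp add: unitary_mat_def)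
  qed
  have inner: "g i \<bullet>c g j = \<delta> i * cnj (\<delta> j) * (f i \<bullet>c f j)" if "i \<in> \<beta>" "j \<in> \<beta>" for i j
    unfolding g_def using fc[OF that(1)] fc[OF that(2)] by (simp add: conjugate_smult_vec)
  have gram: "g i \<bullet>c g j = (if i = j then of_nat N else 0) - 1" if "i \<in> \<beta>" "j \<in> \<beta>" for i j
    using that \<delta>[of j] norm[of j] phases[of i j] by (auto simp: inner complex_norm_square[symmetric])
  have gram_sum: "(\<Sum>j\<in>\<beta>. g i \<bullet>c g j) = 0" "(\<Sum>j\<in>\<beta>. g j \<bullet>c g i) = 0" if "i \<in> \<beta>" for i
    using that finb card by (simp_all add: gram sum_subtractf cong: sum.cong)
  \<comment> \<open>The rows of \<open>N I - J\<close> sum to zero because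
    \<open>card \<beta> = N\<close>. Hence the sum \<open>s\<close> of the vectors is orthogonal to
    each of them, so to itself, and vanishes.\<close>
  have sum0: "(\<Sum>j\<in>\<beta>. g j $ r) = 0" if "r < d" for r
  proof -
    define s where "s = vec d (\<lambda>r. \<Sum>j\<in>\<beta>. g j $ r)"
    have sc: "s \<in> carrier_vec d" by (simp add: s_def)
    have *: "s \<bullet>c w = (\<Sum>j\<in>\<beta>. g j \<bullet>c w)" if "w \<in> carrier_vec d" for w
    proof -
      have "s \<bullet>c w = (\<Sum>r<d. \<Sum>j\<in>\<beta>. g j $ r * cnj (w $ r))"
        using that by (simp add: s_def scalar_prod_def lessThan_atLeast0 sum_distrib_right)
      also have "\<dots> = (\<Sum>j\<in>\<beta>. \<Sum>r<d. g j $ r * cnj (w $ r))" by (rule sum.swap)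
      also have "\<dots> = (\<Sum>j\<in>\<beta>. g j \<bullet>c w)"
        using that by (auto simp: scalar_prod_def lessThan_atLeast0 intro!: sum.cong)
      finally show ?thesis .
    qed
    have "s \<bullet>c s = (\<Sum>j\<in>\<beta>. g j \<bullet>c s)" by (rule *[OF sc])
    also have "\<dots> = (\<Sum>j\<in>\<beta>. cnj (s \<bullet>c g j))"
      by (intro sum.cong refl cscalar_prod_commute[OF sc] gc)
    also have "\<dots> = 0" by (intro sum.neutral) (simp add: * gram_sum)
    finally have "s = 0\<^sub>v d" using sc by simp
    then show ?thesis using that unfolding s_def by (metis index_vec index_zero_vec(1))
  qed
  define W where "W = {x \<in> carrier_vec d. \<forall>r<d. (\<Sum>j\<in>\<beta>. (x \<bullet>c g j) * g j $ r) = of_nat N * x $ r}"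
  have Wc: "W \<subseteq> carrier_vec d" by (auto simp: W_def)
  have sub: "VectorSpace.subspace class_ring W V"
    unfolding VectorSpace.subspace_def
  proof
    show "vectorspace class_ring V" by (rule vec_vs)
    have add: "x + y \<in> W" if "x \<in> W" "y \<in> W" for x y
    proof -
      have "x \<in> carrier_vec d" "y \<in> carrier_vec d" using that Wc by auto
      moreover from this have "(x + y) \<bullet>c g j = x \<bullet>c g j + y \<bullet>c g j" if "j \<in> \<beta>" for j
        using that by (intro add_scalar_prod_distrib[of _ d]) auto
      ultimately show ?thesis
        using that by (simp add: W_def distrib_right distrib_left sum.distrib cong: sum.cong)
    qed
    have smult: "c \<cdot>\<^sub>v x \<in> W" if "x \<in> W" for c x
    proof -
      have "x \<in> carrier_vec d" using that Wc by auto
      moreover from this have "(c \<cdot>\<^sub>v x) \<bullet>c g j = c * (x \<bullet>c g j)" if "j \<in> \<beta>" for j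
        using that by (intro smult_scalar_prod_distrib[of _ d]) auto
      moreover have "(\<Sum>j\<in>\<beta>. c * (x \<bullet>c g j) * g j $ r) = of_nat N * (c * x $ r)" if "r < d" for r
      proof -
        have "(\<Sum>j\<in>\<beta>. (x \<bullet>c g j) * g j $ r) = of_nat N * x $ r"
          using \<open>x \<in> W\<close> that by (simp add: W_def)
        then show ?thesis by (simp add: mult.assoc mult.left_commute flip: sum_distrib_left)
      qed
      ultimately show ?thesis
        by (simp add: W_def cong: sum.cong)
    qed
    show "submodule class_ring W V"
      unfolding submodule_def
      using Wc add smult vec_module by (auto simp: module_vec_simps W_def)
  qed
  \<comment> \<open>Row \<open>i\<close> of the Gram matrix is \<open>N\<close> times a unit vector
    minus the all-ones vector, and the latter contributes nothing by \<open>sum0\<close>.\<close>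
  have gW: "g i \<in> W" if "i \<in> \<beta>" for i
  proof -
    have "(\<Sum>j\<in>\<beta>. (g i \<bullet>c g j) * g j $ r) = of_nat N * g i $ r" if r: "r < d" for r
    proof -
      have "(\<Sum>j\<in>\<beta>. (g i \<bullet>c g j) * g j $ r) = (\<Sum>j\<in>\<beta>. (if i = j then of_nat N * g j $ r else 0) - g j $ r)"
        by (intro sum.cong) (auto simp: gram \<open>i \<in> \<beta>\<close> algebra_simps)
      then show ?thesis using \<open>i \<in> \<beta>\<close> finb sum0[OF r] by (simp add: sum_subtractf)
    qed
    then show ?thesis using that by (simp add: W_def)
  qed
  have tight: "(\<Sum>j\<in>\<beta>. complex_of_real ((cmod (x \<bullet>c g j))\<^sup>2)) = complex_of_real (real N) * (x \<bullet>c x)"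
    if "x \<in> W" for x
  proof -
    have xc: "x \<in> carrier_vec d" using that Wc by auto
    \<comment> \<open>Tightness is the eigenvalue equation paired with \<open>x\<close>.\<close>
    have "complex_of_real (real N) * (x \<bullet>c x) = (\<Sum>r<d. of_nat N * x $ r * cnj (x $ r))"
      using xc by (simp add: scalar_prod_def lessThan_atLeast0 sum_distrib_left mult.assoc)
    also have "\<dots> = (\<Sum>r<d. (\<Sum>j\<in>\<beta>. (x \<bullet>c g j) * g j $ r) * cnj (x $ r))"
      using that by (intro sum.cong) (auto simp: W_def)
    also have "\<dots> = (\<Sum>r<d. \<Sum>j\<in>\<beta>. (x \<bullet>c g j) * (g j $ r * cnj (x $ r)))"
      by (simp add: sum_distrib_right mult.assoc)
    also have "\<dots> = (\<Sum>j\<in>\<beta>. \<Sum>r<d. (x \<bullet>c g j) * (g j $ r * cnj (x $ r)))"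
      by (rule sum.swap)
    also have "\<dots> = (\<Sum>j\<in>\<beta>. (x \<bullet>c g j) * (g j \<bullet>c x))"
      using xc by (auto simp: scalar_prod_def lessThan_atLeast0 sum_distrib_left intro!: sum.cong)
    also have "\<dots> = (\<Sum>j\<in>\<beta>. complex_of_real ((cmod (x \<bullet>c g j))\<^sup>2))"
      by (intro sum.cong refl, subst cscalar_prod_commute[OF xc gc])
         (simp_all add: complex_norm_square[symmetric])
    finally show ?thesis by simp
  qed
  have "\<beta> \<noteq> {}" using card N by auto
  then obtain i0 where i0: "i0 \<in> \<beta>" by blast
  define A where "A = g ` (\<beta> - {i0})"
  have "inj_on g \<beta>"
  proof (rule inj_onI, rule ccontr)
    fix i j assume ij: "i \<in> \<beta>" "j \<in> \<beta>" "g i = g j" "i \<noteq> j"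
    then have "(of_nat N :: complex) - 1 = -1" using gram[of i j] gram[of j j] by simp
    then show False using N by simp
  qed
  then have inj: "inj_on g (\<beta> - {i0})" by (rule inj_on_subset) auto
  have cardA: "card A + 1 = N"
    unfolding A_def using inj i0 finb card N by (simp add: card_image)
  have A: "finite A" "A \<subseteq> W" using gW finb by (auto simp: A_def)
  have "lin_indpt A"
    by (rule lin_indpt_simplex_gram[of _ _ N]) (use A Wc cardA N gram in \<open>auto simp: A_def\<close>)
  moreover have "W \<subseteq> span A"
  proof
    fix x assume x: "x \<in> W"
    \<comment> \<open>The frame expansion has coefficients \<open>(x \<bullet>c v) / N\<close>.
      Subtracting a constant multiple of the vanishing sum of all vectors makes the coefficient at
      \<open>g i0\<close> zero.\<close>
    define a where "a v = (x \<bullet>c v - x \<bullet>c g i0) / of_nat N" for v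
    have "x = lincomb a A"
    proof (rule eq_vecI)
      show "dim_vec x = dim_vec (lincomb a A)" using x Wc A by (subst lincomb_dim) auto
      fix r assume "r < dim_vec (lincomb a A)"
      then have r: "r < d" using A Wc by (subst (asm) lincomb_dim) auto
      have "lincomb a A $ r = (\<Sum>v\<in>A. a v * v $ r)" using A Wc r by (intro lincomb_index) auto
      also have "\<dots> = (\<Sum>j\<in>\<beta> - {i0}. a (g j) * g j $ r)" unfolding A_def by (simp add: sum.reindex inj)
      also have "\<dots> = (\<Sum>j\<in>\<beta>. a (g j) * g j $ r)"
        using finb i0 by (simp add: sum.remove[of \<beta> i0] a_def)
      also have "\<dots> = ((\<Sum>j\<in>\<beta>. (x \<bullet>c g j) * g j $ r) - (x \<bullet>c g i0) * (\<Sum>j\<in>\<beta>. g j $ r)) / of_nat N"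
        by (simp add: a_def sum_divide_distrib sum_distrib_left algebra_simps diff_divide_distrib
            flip: sum_subtractf)
      also have "\<dots> = x $ r" using x r N by (simp add: W_def sum0)
      finally show "x $ r = lincomb a A $ r" by simp
    qed
    then show "x \<in> span A" unfolding span_def using A by auto
  qed
  ultimately have "subspace_dim d W = card A"
    using sub A by (intro dim_eq_card_basis) auto
  moreover have "switching_equivalent d \<beta> f g"
    unfolding switching_equivalent_def
    by (rule exI[of _ "1\<^sub>m d"], rule exI[of _ id], rule exI[of _ \<delta>])
       (use U \<delta> fc in \<open>auto simp: g_def permutes_id\<close>)
  moreover have "ETF_for d W \<beta> g"
    unfolding ETF_for_def tight_frame_for_def
  proof (intro conjI)
    show "\<exists>A::real. A > 0 \<and> (\<forall>x\<in>W. (\<Sum>j\<in>\<beta>. complex_of_real ((cmod (x \<bullet>c g j))\<^sup>2)) = complex_of_real A * (x \<bullet>c x))"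
      by (rule exI[of _ "real N"]) (use N tight in auto)
    show "\<exists>r. \<forall>j\<in>\<beta>. g j \<bullet>c g j = r" using gram by (intro exI[of _ "of_nat N - 1"]) auto
    show "\<exists>\<mu>. \<forall>i\<in>\<beta>. \<forall>j\<in>\<beta>. i \<noteq> j \<longrightarrow> cmod (g i \<bullet>c g j) = \<mu>" using gram by (intro exI[of _ 1]) auto
  qed (use sub finb gW in auto)
  ultimately show ?thesis
    unfolding is_simplex_def using cardA card gram
    by (intro exI[of _ W] exI[of _ g]) auto
qed

section \<open>Integers modulo a prime\<close>

lemma rep_less: "rep (x :: 'p::prime_card mod_ring) < CARD('p)"
  and of_nat_rep [simp]: "of_nat (rep x) = x"
proof -
  have r: "to_int_mod_ring x \<in> {0..<int CARD('p)}"
    using range_to_int_mod_ring[where ?'a = 'p] by blast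
  then show "rep x < CARD('p)" by (simp add: rep_def nat_less_iff)
  have "int (rep x) = to_int_mod_ring x"
    using r by (simp add: rep_def)
  then have "(of_int (int (rep x)) :: 'p mod_ring) = x"
    by (simp only: of_int_of_int_mod_ring of_int_mod_ring_to_int_mod_ring)
  then show "of_nat (rep x) = x" by (simp only: of_int_of_nat_eq)
qed

lemma rep_of_nat:
  assumes "a < CARD('p::prime_card)"
  shows "rep (of_nat a :: 'p mod_ring) = a"
  using assms by (simp add: rep_def of_nat_of_int_mod_ring)

lemma rep_eq_iff: "rep x = rep y \<longleftrightarrow> x = y"
  by (metis of_nat_rep)

lemma of_nat_mod_card: "of_nat (a mod CARD('p)) = (of_nat a :: 'p::prime_card mod_ring)"
proof -
  have "of_nat a = (of_nat (CARD('p) * (a div CARD('p)) + a mod CARD('p)) :: 'p mod_ring)"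
    by simp
  then show ?thesis by (simp only: of_nat_add of_nat_mult of_nat_card_eq_0) simp
qed

lemma rep_add: "rep (x + y) = (rep x + rep y) mod CARD('p)" for x y :: "'p::prime_card mod_ring"
proof -
  have "rep (of_nat ((rep x + rep y) mod CARD('p)) :: 'p mod_ring) = (rep x + rep y) mod CARD('p)"
    by (rule rep_of_nat) simp
  moreover have "(of_nat ((rep x + rep y) mod CARD('p)) :: 'p mod_ring) = x + y"
    by (simp add: of_nat_mod_card)
  ultimately show ?thesis by (simp only:)
qed

lemma rep_zero [simp]: "rep (0 :: 'p::prime_card mod_ring) = 0"
  using rep_of_nat[of 0, where ?'p = 'p] by simp

text \<open>The shift by 1 makes the reflection reverse the order of the representatives in
  \<open>{0..<p}\<close>.\<close>

lemma rep_minus_minus_one: "rep (- x - 1 :: 'p::prime_card mod_ring) = CARD('p) - 1 - rep x"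
proof -
  have "- x - 1 = (of_nat (CARD('p) - 1 - rep x) :: 'p mod_ring)"
    using rep_less[of x] by (simp add: of_nat_diff)
  then show ?thesis by (simp add: rep_of_nat)
qed

section \<open>The additive character\<close>

definition chi :: "complex \<Rightarrow> 'p::prime_card mod_ring \<Rightarrow> complex" where
  "chi \<zeta> x = \<zeta> ^ rep x"

context
  fixes \<zeta> :: complex and ty :: "'p::prime_card itself"
  assumes prim: "primitive_root_of_unity CARD('p) \<zeta>"
begin

lemma zeta_pow: "\<zeta> ^ CARD('p) = 1"
  using prim by (simp add: primitive_root_of_unity_def)

lemma cmod_zeta: "cmod \<zeta> = 1"
proof -
  have "cmod \<zeta> ^ CARD('p) = 1 ^ CARD('p)" using zeta_pow by (simp flip: norm_power)
  then show ?thesis using power_eq_iff_eq_base[of "CARD('p)" "cmod \<zeta>" 1] by simp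
qed

lemma cmod_chi: "cmod (chi \<zeta> (x :: 'p mod_ring)) = 1"
  by (simp add: chi_def norm_power cmod_zeta)

lemma chi_zero [simp]: "chi \<zeta> (0 :: 'p mod_ring) = 1"
  by (simp add: chi_def)

lemma chi_add: "chi \<zeta> (x + y) = chi \<zeta> x * chi \<zeta> (y :: 'p mod_ring)"
proof -
  have *: "\<zeta> ^ n = \<zeta> ^ (n mod CARD('p))" for n
  proof -
    have "\<zeta> ^ n = \<zeta> ^ (CARD('p) * (n div CARD('p)) + n mod CARD('p))" by simp
    then show ?thesis by (simp only: power_add power_mult zeta_pow) simp
  qed
  then show ?thesis using *[of "rep x + rep y"] unfolding chi_def rep_add by (simp only: power_add)
qed

lemma cnj_chi: "cnj (chi \<zeta> x) = chi \<zeta> (- x :: 'p mod_ring)"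
proof -
  have "chi \<zeta> x * chi \<zeta> (- x) = 1" by (simp flip: chi_add)
  moreover have "chi \<zeta> x * cnj (chi \<zeta> x) = 1" using cmod_chi[of x] by (simp add: complex_norm_square[symmetric])
  moreover have "chi \<zeta> x \<noteq> 0" using cmod_chi[of x] by auto
  ultimately show ?thesis by (metis mult_left_cancel)
qed

text \<open>Primitivity makes the character faithful, so that a product of phases equal to 1 becomes
  an equation in the field.\<close>

lemma chi_eq_1_iff: "chi \<zeta> x = 1 \<longleftrightarrow> x = (0 :: 'p mod_ring)"
proof
  assume "chi \<zeta> x = 1"
  then have "rep x = 0"
    using prim rep_less[of x] by (auto simp: primitive_root_of_unity_def chi_def)
  then show "x = 0" by (metis rep_eq_iff rep_zero)
qed simp

text \<open>Translating the summation variable by 1 multiplies the sum by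
  \<open>chi \<zeta> m\<close>, which differs from 1 when \<open>m \<noteq> 0\<close>.\<close>

lemma sum_chi: "(\<Sum>x\<in>UNIV. chi \<zeta> (m * x)) = (if m = 0 then of_nat CARD('p) else 0)" for m :: "'p mod_ring"
proof (cases "m = 0")
  case False
  define S where "S = (\<Sum>x\<in>UNIV. chi \<zeta> (m * x))"
  have "bij (\<lambda>x :: 'p mod_ring. x + 1)"
    by (rule o_bij[of "\<lambda>x. x - 1"]) (auto simp: fun_eq_iff)
  then have "S = (\<Sum>x\<in>UNIV. chi \<zeta> (m * (x + 1)))"
    unfolding S_def by (intro sum.reindex_bij_betw[symmetric]) simp
  also have "\<dots> = chi \<zeta> m * S"
    by (simp add: S_def distrib_left chi_add sum_distrib_left mult.commute)
  finally have "S = chi \<zeta> m * S" .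
  then have "S = 0" using False chi_eq_1_iff[of m] mult_cancel_right1[of S "chi \<zeta> m"] by blast
  then show ?thesis using False by (simp add: S_def)
qed simp

end

section \<open>Coordinates\<close>

text \<open>The lexicographic rank, which is the coordinate number used in \<open>basis_vec\<close>;
  it allows coordinates to be indexed by group elements.\<close>

definition idx :: "'p::prime_card grp \<Rightarrow> nat" where
  "idx j = rep (fst j) * CARD('p) + rep (snd j)"

lemma concat_map_upt:
  "concat (map (\<lambda>a. map (\<lambda>b. a * n + b) [0..<n]) [0..<m]) = [0..<m * n]"
proof (induction m)
  case (Suc m)
  have "map (\<lambda>b. m * n + b) [0..<n] = [m * n..<n + m * n]"
    using map_add_upt[of "m * n" n] by (simp add: add.commute)
  with Suc show ?case
    using upt_add_eq_append[of 0 "m * n" n] by (simp add: add.commute)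
qed simp

text \<open>Length and distinctness of \<open>lex_list\<close>, and the fact that it inverts
  \<open>idx\<close>, are all read off from this equation.\<close>

lemma map_idx_lex_list: "map idx (lex_list :: 'p::prime_card grp list) = [0..<CARD('p)\<^sup>2]"
proof -
  have "map idx (lex_list :: 'p grp list) = concat (map (\<lambda>a. map (\<lambda>b. a * CARD('p) + b) [0..<CARD('p)]) [0..<CARD('p)])"
    unfolding lex_list_def map_concat
    by (rule arg_cong[of _ _ concat]) (auto simp: idx_def rep_of_nat)
  then show ?thesis unfolding concat_map_upt by (simp add: power2_eq_square)
qed

lemma idx_eq_iff: "idx a = idx b \<longleftrightarrow> a = (b :: 'p::prime_card grp)"
proof
  assume e: "idx a = idx b"
  have "idx x div CARD('p) = rep (fst x) \<and> idx x mod CARD('p) = rep (snd x)" for x :: "'p grp"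
    using rep_less[of "snd x"] by (simp add: idx_def)
  with e show "a = b" by (metis prod_eq_iff rep_eq_iff)
qed simp

lemma length_lex_list [simp]: "length (lex_list :: 'p::prime_card grp list) = CARD('p)\<^sup>2"
  using arg_cong[OF map_idx_lex_list[where ?'p = 'p], of length] by simp

lemma idx_lex_list: "i < CARD('p)\<^sup>2 \<Longrightarrow> idx ((lex_list :: 'p::prime_card grp list) ! i) = i"
  using arg_cong[OF map_idx_lex_list[where ?'p = 'p], of "\<lambda>xs. xs ! i"] by simp

lemma idx_less: "idx (a :: 'p::prime_card grp) < CARD('p)\<^sup>2"
proof -
  have "idx a < rep (fst a) * CARD('p) + CARD('p)"
    using rep_less[of "snd a"] by (simp add: idx_def)
  also have "\<dots> = (rep (fst a) + 1) * CARD('p)" by simp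
  also have "\<dots> \<le> CARD('p) * CARD('p)" using rep_less[of "fst a"] by (intro mult_right_mono) auto
  finally show ?thesis by (simp add: power2_eq_square)
qed

lemma lex_list_idx [simp]: "lex_list ! idx a = a"
  using idx_lex_list[OF idx_less] idx_eq_iff by metis

lemma distinct_lex_list: "distinct (lex_list :: 'p::prime_card grp list)"
proof -
  have "distinct (map idx (lex_list :: 'p grp list))" unfolding map_idx_lex_list by simp
  then show ?thesis by (simp add: distinct_map)
qed

lemma set_lex_list: "set (lex_list :: 'p::prime_card grp list) = UNIV"
proof -
  have "a \<in> set lex_list" for a :: "'p grp"
    using nth_mem[of "idx a" "lex_list :: 'p grp list"] idx_less[of a] by simp
  then show ?thesis by blast
qed

lemma bij_betw_idx: "bij_betw idx (UNIV :: 'p::prime_card grp set) {..<CARD('p)\<^sup>2}"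
  unfolding bij_betw_def
proof
  show "inj (idx :: 'p grp \<Rightarrow> nat)" by (simp add: inj_def idx_eq_iff)
  show "range (idx :: 'p grp \<Rightarrow> nat) = {..<CARD('p)\<^sup>2}"
  proof
    show "{..<CARD('p)\<^sup>2} \<subseteq> range (idx :: 'p grp \<Rightarrow> nat)"
    proof
      fix i assume "i \<in> {..<CARD('p)\<^sup>2}"
      then have "i = idx (lex_list ! i :: 'p grp)" using idx_lex_list[where ?'p = 'p] by simp
      then show "i \<in> range (idx :: 'p grp \<Rightarrow> nat)" by (rule range_eqI)
    qed
  qed (use idx_less in blast)
qed

lemma sum_idx: "(\<Sum>i<CARD('p)\<^sup>2. F i) = (\<Sum>a\<in>UNIV. F (idx (a :: 'p::prime_card grp)))"
  by (rule sum.reindex_bij_betw[OF bij_betw_idx, symmetric])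

text \<open>The reflection replaces each base \<open>p\<close> digit \<open>r\<close> of the rank by
  \<open>p - 1 - r\<close>, which reverses the whole order.\<close>

lemma idx_reflect: "idx (- a - (1, 1) :: 'p::prime_card grp) = CARD('p)\<^sup>2 - 1 - idx a"
proof -
  have "rep (fst a) < CARD('p)" "rep (snd a) < CARD('p)" by (rule rep_less)+
  \<comment> \<open>The complements of the digits are named to avoid truncated subtraction.\<close>
  then obtain u v where "CARD('p) = rep (fst a) + 1 + u" "CARD('p) = rep (snd a) + 1 + v"
    by (metis add.commute less_iff_Suc_add plus_1_eq_Suc add.assoc)
  moreover have "idx (- a - (1, 1)) = (CARD('p) - 1 - rep (fst a)) * CARD('p) + (CARD('p) - 1 - rep (snd a))"
    by (simp add: idx_def rep_minus_minus_one)
  ultimately have "idx (- a - (1, 1)) + idx a + 1 = (u + 1 + rep (fst a)) * CARD('p)"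
    by (simp add: idx_def algebra_simps)
  also have "\<dots> = CARD('p)\<^sup>2"
    using \<open>CARD('p) = rep (fst a) + 1 + u\<close> by (simp add: power2_eq_square add_ac)
  finally show ?thesis by simp
qed

lemma lex_less_iff: "lex_less i j \<longleftrightarrow> idx i < idx (j :: 'p::prime_card grp)"
proof -
  have *: "idx i < idx j" if "rep (fst i) < rep (fst j)" for i j :: "'p grp"
  proof -
    have "idx i < (rep (fst i) + 1) * CARD('p)" using rep_less[of "snd i"] by (simp add: idx_def)
    also have "\<dots> \<le> rep (fst j) * CARD('p)" using that by (intro mult_right_mono) auto
    finally show ?thesis by (simp add: idx_def)
  qed
  consider "rep (fst i) < rep (fst j)" | "rep (fst j) < rep (fst i)" | "rep (fst i) = rep (fst j)"
    by linarith
  then show ?thesis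
  proof cases
    case 3
    then show ?thesis by (auto simp: lex_less_def idx_def rep_eq_iff)
  next
    case 2
    with *[of j i] show ?thesis by (auto simp: lex_less_def)
  qed (use * lex_less_def in blast)
qed

text \<open>Both digits equal \<open>m = (p - 1) / 2\<close>, so the rank is \<open>m p + m\<close>,
  the middle one. The center is thus the fixed point of the reflection.\<close>

lemma idx_center:
  assumes "odd CARD('p::prime_card)"
  shows "idx (center :: 'p grp) = (CARD('p)\<^sup>2 - 1) div 2"
proof -
  obtain m where m: "CARD('p) = 2 * m + 1" using assms by (rule oddE)
  have "m < CARD('p)" using m by simp
  then have "rep (of_nat m :: 'p mod_ring) = m" by (rule rep_of_nat)
  then have "idx (center :: 'p grp) = m * (2 * m + 1) + m" by (simp add: center_def idx_def m)
  then show ?thesis by (simp add: m power2_eq_square algebra_simps)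
qed


section \<open>The frame vectors\<close>

definition dot :: "'p::prime_card grp \<Rightarrow> 'p grp \<Rightarrow> 'p mod_ring" where
  "dot x y = fst x * fst y + snd x * snd y"

text \<open>The index set is kept as a list because its positions number the blocks of the fiducial
  vector.\<close>

definition halves :: "'p::prime_card grp list" where
  "halves = filter (\<lambda>i. lex_less i center) lex_list"

lemma set_halves:
  assumes "odd CARD('p::prime_card)"
  shows "set (halves :: 'p grp list) = {a. idx a < (CARD('p)\<^sup>2 - 1) div 2}"
  using assms by (simp add: halves_def set_lex_list lex_less_iff idx_center)

lemma distinct_halves: "distinct halves"
  by (simp add: halves_def distinct_lex_list)

lemma length_halves:
  assumes "odd CARD('p::prime_card)"
  shows "length (halves :: 'p grp list) = (CARD('p)\<^sup>2 - 1) div 2"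
proof -
  let ?m = "(CARD('p)\<^sup>2 - 1) div 2"
  have "length (halves :: 'p grp list) = card (set (halves :: 'p grp list))"
    by (simp add: distinct_card distinct_halves)
  also have "\<dots> = card (idx -` {..<?m} :: 'p grp set)"
    unfolding set_halves[OF assms] by (simp add: vimage_def)
  also have "\<dots> = card {..<?m}"
    using bij_betw_idx[where ?'p = 'p]
    by (intro card_vimage_inj) (auto simp: bij_betw_def)
  finally show ?thesis by simp
qed

lemma phi_carrier [simp]: "phi (i :: 'p::prime_card grp) \<in> carrier_vec (CARD('p)\<^sup>2)"
  by (simp add: phi_def basis_vec_def)

lemma basis_vec_nth: "basis_vec (j :: 'p::prime_card grp) $ idx a = (if a = j then 1 else 0)"
  using idx_less[of a] idx_less[of j] idx_eq_iff[of a j] by (simp add: basis_vec_def flip: idx_def)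

text \<open>The reflection is moved from \<open>i\<close> to \<open>a\<close>, so that both terms
  are delta functions of \<open>i\<close> and can be summed over \<open>i\<close>.\<close>

lemma phi_nth:
  fixes a i :: "'p::prime_card grp"
  shows "phi i $ idx a = (if a = i then 1 else 0) - (if - a - (1, 1) = i then 1 else 0)"
proof -
  have "a = - i - (1, 1) \<longleftrightarrow> - a - (1, 1) = i"
    by auto
  moreover have "phi i $ idx a = basis_vec i $ idx a - basis_vec (- i - (1, 1)) $ idx a"
    using idx_less[of a] by (simp add: phi_def basis_vec_def)
  ultimately show ?thesis by (simp add: basis_vec_nth)
qed

section \<open>Block structure of the fiducial vector\<close>

lemma sum_lessThan_mult:
  fixes F :: "nat \<Rightarrow> 'a::comm_monoid_add"
  shows "(\<Sum>s<m * n. F s) = (\<Sum>q<m. \<Sum>r<n. F (q * n + r))"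
proof -
  have "(\<Sum>s<m * n. F s) = (\<Sum>q<m. sum F {q * n..<q * n + n})"
    by (rule sum.nat_group[symmetric])
  moreover have "sum F {q * n..<q * n + n} = (\<Sum>r<n. F (q * n + r))" for q
    using sum.shift_bounds_nat_ivl[of F 0 "q * n" n] by (simp add: add.commute lessThan_atLeast0)
  ultimately show ?thesis by simp
qed

lemma concat_nth_uniform:
  assumes "\<And>xs. xs \<in> set xss \<Longrightarrow> length xs = n" "q < length xss" "r < n"
  shows "concat xss ! (q * n + r) = xss ! q ! r"
  using assms
proof (induction xss arbitrary: q)
  case (Cons xs xss)
  then show ?case by (cases q) (auto simp: nth_append)
qed simp

lemma length_concat_uniform:
  assumes "\<And>xs. xs \<in> set xss \<Longrightarrow> length xs = n"
  shows "length (concat xss) = length xss * n"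
  using assms by (induction xss) auto

lemma fiducial_carrier:
  "fiducial TYPE('p::prime_card) \<in> carrier_vec (length (halves :: 'p grp list) * CARD('p)\<^sup>2)"
  unfolding fiducial_def carrier_vec_def halves_def[symmetric] mem_Collect_eq
  by (subst dim_vec_of_list, subst length_concat_uniform[where n = "CARD('p)\<^sup>2"])
    (use phi_carrier[where ?'p = 'p] in auto)

lemma fiducial_nth:
  assumes "q < length (halves :: 'p::prime_card grp list)" "r < CARD('p)\<^sup>2"
  shows "fiducial TYPE('p) $ (q * CARD('p)\<^sup>2 + r) = phi (halves ! q :: 'p grp) $ r"
proof -
  have "fiducial TYPE('p) $ (q * CARD('p)\<^sup>2 + r)
      = concat (map (\<lambda>i :: 'p grp. list_of_vec (phi i)) halves) ! (q * CARD('p)\<^sup>2 + r)"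
    unfolding fiducial_def halves_def[symmetric] by (rule vec_of_list_index)
  also have "\<dots> = map (\<lambda>i :: 'p grp. list_of_vec (phi i)) halves ! q ! r"
    by (rule concat_nth_uniform) (use assms phi_carrier[where ?'p = 'p] in auto)
  also have "\<dots> = phi (halves ! q :: 'p grp) $ r"
    using assms by (simp add: list_of_vec_index)
  finally show ?thesis .
qed

section \<open>Translations, modulations and their Kronecker product with the identity\<close>

lemma translation_carrier: "translation (k :: 'p::prime_card grp) \<in> carrier_mat (CARD('p)\<^sup>2) (CARD('p)\<^sup>2)"
  unfolding translation_def
  by (rule carrier_matI) (simp_all only: mat_of_cols_carrier length_map length_lex_list)

lemma modulation_carrier: "modulation \<zeta> (\<kappa> :: 'p::prime_card grp) \<in> carrier_mat (CARD('p)\<^sup>2) (CARD('p)\<^sup>2)"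
  unfolding modulation_def
  by (rule carrier_matI) (simp_all only: mat_of_cols_carrier length_map length_lex_list)

lemma mult_mat_vec_idx:
  fixes a :: "'p::prime_card grp"
  assumes "B \<in> carrier_mat (CARD('p)\<^sup>2) (CARD('p)\<^sup>2)" "v \<in> carrier_vec (CARD('p)\<^sup>2)"
  shows "(B *\<^sub>v v) $ idx a = (\<Sum>b\<in>UNIV. B $$ (idx a, idx (b :: 'p grp)) * v $ idx b)"
proof -
  have "(B *\<^sub>v v) $ idx a = (\<Sum>i<CARD('p)\<^sup>2. B $$ (idx a, i) * v $ i)"
    using assms idx_less[of a] by (simp add: scalar_prod_def lessThan_atLeast0)
  then show ?thesis unfolding sum_idx .
qed

lemma translation_mult_vec:
  fixes a k :: "'p::prime_card grp"
  assumes "v \<in> carrier_vec (CARD('p)\<^sup>2)"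
  shows "(translation k *\<^sub>v v) $ idx a = v $ idx (a - k)"
proof -
  have "translation k $$ (idx a, idx b) = (if b = a - k then 1 else 0)" for b
  proof -
    have "translation k $$ (idx a, idx b) = basis_vec (b + k) $ idx a"
      unfolding translation_def using idx_less[of a] idx_less[of b] by (simp add: mat_of_cols_index)
    also have "\<dots> = (if b = a - k then 1 else 0)" by (auto simp: basis_vec_nth)
    finally show ?thesis .
  qed
  then have "(translation k *\<^sub>v v) $ idx a = (\<Sum>b\<in>UNIV. if b = a - k then v $ idx b else 0)"
    unfolding mult_mat_vec_idx[OF translation_carrier assms] by (intro sum.cong) auto
  then show ?thesis by simp
qed

lemma modulation_mult_vec:
  fixes a \<kappa> :: "'p::prime_card grp"
  assumes "v \<in> carrier_vec (CARD('p)\<^sup>2)"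
  shows "(modulation \<zeta> \<kappa> *\<^sub>v v) $ idx a = chi \<zeta> (dot \<kappa> a) * v $ idx a"
proof -
  have "modulation \<zeta> \<kappa> $$ (idx a, idx b) = (if b = a then chi \<zeta> (dot \<kappa> a) else 0)" for b
  proof -
    have "modulation \<zeta> \<kappa> $$ (idx a, idx b) = (chi \<zeta> (dot \<kappa> b) \<cdot>\<^sub>v basis_vec b) $ idx a"
      unfolding modulation_def using idx_less[of a] idx_less[of b]
      by (simp add: mat_of_cols_index chi_def dot_def)
    also have "\<dots> = chi \<zeta> (dot \<kappa> b) * basis_vec b $ idx a"
      using idx_less[of a] by (simp add: basis_vec_def)
    also have "\<dots> = (if b = a then chi \<zeta> (dot \<kappa> a) else 0)" by (auto simp: basis_vec_nth)
    finally show ?thesis .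
  qed
  then have "(modulation \<zeta> \<kappa> *\<^sub>v v) $ idx a
      = (\<Sum>b\<in>UNIV. if b = a then chi \<zeta> (dot \<kappa> a) * v $ idx b else 0)"
    unfolding mult_mat_vec_idx[OF modulation_carrier assms] by (intro sum.cong) auto
  then show ?thesis by simp
qed

text \<open>Tensoring with the identity acts on each block separately, so block \<open>q\<close> of
  the product depends only on block \<open>q\<close> of \<open>f\<close>, which is
  \<open>g\<close>.\<close>

lemma kronecker_one_mult_vec:
  assumes B: "B \<in> carrier_mat n n" and f: "f \<in> carrier_vec (m * n)" and g: "g \<in> carrier_vec n"
    and q: "q < m" and r: "r < n" and fg: "\<And>s. s < n \<Longrightarrow> f $ (q * n + s) = g $ s"
  shows "(kronecker (1\<^sub>m m) B *\<^sub>v f) $ (q * n + r) = (B *\<^sub>v g) $ r"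
proof -
  have qn: "q' * n + s < m * n" if "q' < m" "s < n" for q' s
  proof -
    have "q' * n + s < (q' + 1) * n" using that by simp
    also have "\<dots> \<le> m * n" using that by (intro mult_right_mono) auto
    finally show ?thesis .
  qed
  have "(kronecker (1\<^sub>m m) B *\<^sub>v f) $ (q * n + r)
      = (\<Sum>t<m * n. kronecker (1\<^sub>m m) B $$ (q * n + r, t) * f $ t)"
    using B f qn[OF q r] by (simp add: kronecker_def scalar_prod_def lessThan_atLeast0)
  also have "\<dots> = (\<Sum>q'<m. \<Sum>s<n. kronecker (1\<^sub>m m) B $$ (q * n + r, q' * n + s) * f $ (q' * n + s))"
    by (rule sum_lessThan_mult)
  also have "\<dots> = (\<Sum>q'<m. if q' = q then \<Sum>s<n. B $$ (r, s) * f $ (q' * n + s) else 0)"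
  proof (intro sum.cong refl)
    fix q' assume q': "q' \<in> {..<m}"
    have "kronecker (1\<^sub>m m) B $$ (q * n + r, q' * n + s) = (if q' = q then B $$ (r, s) else 0)"
      if "s < n" for s
      using B q q' r that qn[of q r] qn[of q' s] by (auto simp: kronecker_def)
    then show "(\<Sum>s<n. kronecker (1\<^sub>m m) B $$ (q * n + r, q' * n + s) * f $ (q' * n + s))
        = (if q' = q then \<Sum>s<n. B $$ (r, s) * f $ (q' * n + s) else 0)"
      by simp
  qed
  also have "\<dots> = (\<Sum>s<n. B $$ (r, s) * g $ s)" using q fg by simp
  also have "\<dots> = (B *\<^sub>v g) $ r"
    using B g r by (simp add: scalar_prod_def lessThan_atLeast0)
  finally show ?thesis .
qed

lemma gs_rep_carrier:
  "gs_rep \<zeta> k (\<kappa> :: 'p::prime_card grp) \<in> carrier_mat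
     ((CARD('p)\<^sup>2 - 1) div 2 * CARD('p)\<^sup>2) ((CARD('p)\<^sup>2 - 1) div 2 * CARD('p)\<^sup>2)"
  unfolding gs_rep_def kronecker_def
  using carrier_matD[OF translation_carrier[of k]] carrier_matD[OF modulation_carrier[of \<zeta> \<kappa>]]
  by (intro carrier_matI) simp_all

lemma gs_frame_carrier:
  "gs_frame \<zeta> (x :: 'p::prime_card grp \<times> 'p grp) \<in> carrier_vec ((CARD('p)\<^sup>2 - 1) div 2 * CARD('p)\<^sup>2)"
proof -
  have "gs_frame \<zeta> x = gs_rep \<zeta> (fst x) (snd x) *\<^sub>v fiducial TYPE('p)"
    by (simp add: gs_frame_def case_prod_beta)
  then show ?thesis
    using carrier_matD(1)[OF gs_rep_carrier[of \<zeta> "fst x" "snd x"]]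
    by (intro carrier_vecI) (simp only: dim_mult_mat_vec)
qed

text \<open>Modulation acts after translation, so the character is evaluated at \<open>a\<close>
  while the block is read at \<open>a - k\<close>.\<close>

lemma gs_frame_nth:
  fixes k \<kappa> a :: "'p::prime_card grp"
  assumes odd: "odd CARD('p)" and q: "q < (CARD('p)\<^sup>2 - 1) div 2"
  shows "gs_frame \<zeta> (k, \<kappa>) $ (q * CARD('p)\<^sup>2 + idx a)
    = chi \<zeta> (dot \<kappa> a) * phi (halves ! q :: 'p grp) $ idx (a - k)"
proof -
  let ?n = "CARD('p)\<^sup>2" and ?M = "modulation \<zeta> \<kappa>" and ?T = "translation k"
  have "gs_frame \<zeta> (k, \<kappa>) $ (q * ?n + idx a) = ((?M * ?T) *\<^sub>v phi (halves ! q :: 'p grp)) $ idx a"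
    unfolding gs_frame_def gs_rep_def prod.case
    using q odd idx_less[of a] modulation_carrier[of \<zeta> \<kappa>] translation_carrier[of k]
    by (intro kronecker_one_mult_vec)
       (use fiducial_carrier[where ?'p = 'p] fiducial_nth[where ?'p = 'p] in \<open>auto simp: length_halves\<close>)
  also have "\<dots> = (?M *\<^sub>v (?T *\<^sub>v phi (halves ! q :: 'p grp))) $ idx a"
    by (simp add: assoc_mult_mat_vec[OF modulation_carrier translation_carrier])
  also have "\<dots> = chi \<zeta> (dot \<kappa> a) * phi (halves ! q :: 'p grp) $ idx (a - k)"
    using mult_mat_vec_carrier[OF translation_carrier[of k] phi_carrier[of "halves ! q :: 'p grp"]]
    by (simp add: modulation_mult_vec translation_mult_vec)
  finally show ?thesis .
qed

section \<open>Inner products of the frame vectors\<close>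

lemma two_nonzero:
  assumes "odd CARD('p::prime_card)"
  shows "(2 :: 'p mod_ring) \<noteq> 0"
proof -
  have "CARD('p) > 1" by (rule nontriv)
  then have "2 < CARD('p)" using assms by (metis One_nat_def Suc_1 Suc_lessI even_numeral)
  then have "rep (of_nat 2 :: 'p mod_ring) = 2" by (rule rep_of_nat)
  then show ?thesis by (metis of_nat_numeral rep_zero zero_neq_numeral)
qed

text \<open>Of two indices exchanged by the reflection exactly one lies in \<open>halves\<close>,
  and only the fixed point has neither; there the two deltas on the right cancel.\<close>

lemma sum_phi:
  fixes a b :: "'p::prime_card grp"
  assumes odd: "odd CARD('p)"
  shows "(\<Sum>i\<in>set (halves :: 'p grp list). phi i $ idx a * cnj (phi i $ idx b))
    = (if a = b then 1 else 0) - (if a = - b - (1, 1) then 1 else 0)"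
proof -
  let ?H = "set (halves :: 'p grp list)" and ?R = "\<lambda>x :: 'p grp. - x - (1, 1)"
  let ?F = "\<lambda>i. (if b = i then 1 else 0) - (if ?R b = i then 1 else 0) :: complex"
  have R1: "?R b = ?R a \<longleftrightarrow> a = b" and R2: "b = ?R a \<longleftrightarrow> a = ?R b" by auto
  have "(\<Sum>i\<in>?H. phi i $ idx a * cnj (phi i $ idx b))
      = (\<Sum>i\<in>?H. (if a = i then ?F i else 0) - (if ?R a = i then ?F i else 0))"
    by (intro sum.cong refl) (simp add: phi_nth)
  also have "\<dots> = (if a \<in> ?H then ?F a else 0) - (if ?R a \<in> ?H then ?F (?R a) else 0)"
    by (simp only: sum_subtractf) simp
  also have "\<dots> = (if a = b then 1 else 0) - (if a = ?R b then 1 else 0)"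
  proof -
    have "odd (CARD('p)\<^sup>2)" using odd by simp
    then obtain m where m: "CARD('p)\<^sup>2 = 2 * m + 1" by (rule oddE)
    have H: "x \<in> ?H \<longleftrightarrow> idx x < m" for x using set_halves[OF odd] m by simp
    have "idx a < 2 * m + 1" using idx_less[of a] m by simp
    moreover have "idx (?R a) = 2 * m - idx a" using idx_reflect[of a] m by simp
    moreover have "a = ?R a \<longleftrightarrow> idx a = idx (?R a)" by (rule idx_eq_iff[symmetric])
    \<comment> \<open>The ranks of \<open>a\<close> and \<open>?R a\<close> add up to
      \<open>2 * m\<close>, so one is below \<open>m\<close> and the other above, or both equal
      \<open>m\<close>.\<close>
    ultimately consider "a \<in> ?H" "?R a \<notin> ?H" | "a \<notin> ?H" "?R a \<in> ?H"
      | "a \<notin> ?H" "?R a \<notin> ?H" "a = ?R a"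
      unfolding H by linarith
    then show ?thesis
    proof cases
      case 3
      then have "a = b \<longleftrightarrow> a = ?R b" using R1 by metis
      with 3 show ?thesis by simp
    qed (use R1 R2 in auto)
  qed
  finally show ?thesis .
qed

lemma sum_chi_dot:
  fixes \<mu> :: "'p::prime_card grp"
  assumes "primitive_root_of_unity CARD('p) \<zeta>"
  shows "(\<Sum>a\<in>UNIV. chi \<zeta> (dot \<mu> a)) = (if \<mu> = 0 then of_nat (CARD('p)\<^sup>2) else 0)"
proof -
  have "(\<Sum>a\<in>UNIV. chi \<zeta> (dot \<mu> a)) = (\<Sum>x\<in>UNIV. \<Sum>y\<in>UNIV. chi \<zeta> (fst \<mu> * x) * chi \<zeta> (snd \<mu> * y))"
    by (simp add: dot_def chi_add[OF assms] sum.cartesian_product case_prod_beta flip: UNIV_Times_UNIV)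
  also have "\<dots> = (\<Sum>x\<in>UNIV. chi \<zeta> (fst \<mu> * x)) * (\<Sum>y\<in>UNIV. chi \<zeta> (snd \<mu> * y))"
    by (rule sum_product[symmetric])
  finally show ?thesis
    by (simp add: sum_chi[OF assms] prod_eq_iff power2_eq_square)
qed

section \<open>Phases and the symplectic form\<close>

definition midpoint :: "'p::prime_card grp \<Rightarrow> 'p grp \<Rightarrow> 'p grp" where
  "midpoint k l = ((fst k + fst l - 1) / 2, (snd k + snd l - 1) / 2)"

text \<open>The exponent contributed by the reflection: the character of the frequency difference,
  evaluated at the one coordinate where the reflection matches the two translates.\<close>

definition phase :: "'p::prime_card grp \<times> 'p grp \<Rightarrow> 'p grp \<times> 'p grp \<Rightarrow> 'p mod_ring" where
  "phase x y = dot (snd x - snd y) (midpoint (fst x) (fst y))"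

lemma phase_self [simp]: "phase x x = 0"
  by (simp add: phase_def dot_def)

lemma phase_commute: "phase y x = - phase x y"
proof -
  have "midpoint (fst y) (fst x) = midpoint (fst x) (fst y)"
    by (simp add: midpoint_def add.commute)
  then show ?thesis by (simp add: phase_def dot_def algebra_simps)
qed

text \<open>Doubling clears the halves. The terms depending on a single point telescope around the
  triangle, and the mixed terms form the symplectic form, whose cyclic sum is its value on the
  differences from \<open>z\<close>.\<close>

lemma phase_cycle:
  fixes x y z :: "'p::prime_card grp \<times> 'p grp"
  assumes "odd CARD('p)"
  shows "2 * (phase x y + phase y z + phase z x) = symp (x - z) (y - z)"
proof -
  have two: "2 * (u * (v / 2)) = u * v" for u v :: "'p mod_ring"
    using two_nonzero[OF assms] by simp
  have "2 * phase u v = (fst (snd u) - fst (snd v)) * (fst (fst u) + fst (fst v) - 1)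
      + (snd (snd u) - snd (snd v)) * (snd (fst u) + snd (fst v) - 1)" for u v :: "'p grp \<times> 'p grp"
    by (simp only: phase_def dot_def midpoint_def distrib_left two fst_conv snd_conv fst_diff snd_diff)
  then show ?thesis
    by (simp only: distrib_left) (simp add: symp_def algebra_simps)
qed

lemma eq_midpoint_iff:
  fixes a k l :: "'p::prime_card grp"
  assumes "odd CARD('p)"
  shows "a - k = - (a - l) - (1, 1) \<longleftrightarrow> a = midpoint k l"
proof -
  have *: "x - u = - (x - v) - 1 \<longleftrightarrow> x = (u + v - 1) / 2" for x u v :: "'p mod_ring"
  proof -
    have "x = (u + v - 1) / 2 \<longleftrightarrow> x * 2 = u + v - 1"
      by (rule nonzero_eq_divide_eq[OF two_nonzero[OF assms]])
    also have "\<dots> \<longleftrightarrow> x * 2 - (u + v - 1) = 0"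
      by (rule right_minus_eq[symmetric])
    also have "x * 2 - (u + v - 1) = (x - u) - (- (x - v) - 1)"
      by (simp add: algebra_simps)
    also have "\<dots> = 0 \<longleftrightarrow> x - u = - (x - v) - 1"
      by (rule right_minus_eq)
    finally show ?thesis by blast
  qed
  show ?thesis unfolding prod_eq_iff midpoint_def
    by (simp only: * fst_diff snd_diff fst_uminus snd_uminus fst_conv snd_conv)
qed

text \<open>Summing over the blocks first leaves \<open>I - R\<close> between translates. The
  identity part is a character sum present only for equal positions, and the reflection part is
  supported at the midpoint.\<close>

lemma gs_frame_cscalar_prod:
  fixes x y :: "'p::prime_card grp \<times> 'p grp"
  assumes odd: "odd CARD('p)" and prim: "primitive_root_of_unity CARD('p) \<zeta>"
  shows "gs_frame \<zeta> x \<bullet>c gs_frame \<zeta> y = (if x = y then of_nat (CARD('p)\<^sup>2) else 0) - chi \<zeta> (phase x y)"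
proof -
  let ?n = "CARD('p)\<^sup>2" and ?m = "(CARD('p)\<^sup>2 - 1) div 2"
  obtain k \<kappa> l \<nu> where x: "x = (k, \<kappa>)" and y: "y = (l, \<nu>)" by (metis prod.collapse)
  let ?\<mu> = "\<kappa> - \<nu>"
  have chi_dot: "chi \<zeta> (dot \<kappa> a) * cnj (chi \<zeta> (dot \<nu> a)) = chi \<zeta> (dot ?\<mu> a)" for a
    by (simp add: cnj_chi[OF prim] dot_def algebra_simps flip: chi_add[OF prim])
  have dims: "dim_vec (gs_frame \<zeta> z) = ?m * ?n" for z :: "'p grp \<times> 'p grp"
    using gs_frame_carrier[of \<zeta> z] by (rule carrier_vecD)
  have "gs_frame \<zeta> x \<bullet>c gs_frame \<zeta> y = (\<Sum>s<?m * ?n. gs_frame \<zeta> x $ s * cnj (gs_frame \<zeta> y $ s))"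
    by (simp add: scalar_prod_def dims lessThan_atLeast0)
  also have "\<dots> = (\<Sum>q<?m. \<Sum>a\<in>UNIV. gs_frame \<zeta> x $ (q * ?n + idx (a :: 'p grp))
      * cnj (gs_frame \<zeta> y $ (q * ?n + idx a)))"
    unfolding sum_lessThan_mult sum_idx ..
  also have "\<dots> = (\<Sum>q<?m. \<Sum>a\<in>UNIV. chi \<zeta> (dot ?\<mu> a)
      * (phi (halves ! q :: 'p grp) $ idx (a - k) * cnj (phi (halves ! q :: 'p grp) $ idx (a - l))))"
    by (intro sum.cong refl) (simp add: x y gs_frame_nth[OF odd] mult_ac flip: chi_dot)
  also have "\<dots> = (\<Sum>a\<in>UNIV. chi \<zeta> (dot ?\<mu> a)
      * (\<Sum>q<?m. phi (halves ! q :: 'p grp) $ idx (a - k) * cnj (phi (halves ! q :: 'p grp) $ idx (a - l))))"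
    by (subst sum.swap) (simp add: sum_distrib_left)
  also have "\<dots> = (\<Sum>a\<in>UNIV. chi \<zeta> (dot ?\<mu> a)
      * (\<Sum>i\<in>set (halves :: 'p grp list). phi i $ idx (a - k) * cnj (phi i $ idx (a - l))))"
    by (simp add: sum.distinct_set_conv_list[OF distinct_halves] sum_list_sum_nth
        length_halves[OF odd] lessThan_atLeast0)
  also have "\<dots> = (\<Sum>a\<in>UNIV. (if k = l then chi \<zeta> (dot ?\<mu> a) else 0)
      - (if a = midpoint k l then chi \<zeta> (dot ?\<mu> a) else 0))"
    by (intro sum.cong refl) (simp only: sum_phi[OF odd] eq_midpoint_iff[OF odd], simp)
  also have "\<dots> = (if k = l then \<Sum>a\<in>UNIV. chi \<zeta> (dot ?\<mu> a) else 0) - chi \<zeta> (dot ?\<mu> (midpoint k l))"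
    by (simp only: sum_subtractf) simp
  finally show ?thesis
    by (simp add: sum_chi_dot[OF prim] phase_def x y)
qed

section \<open>The binder as the set of affine Lagrangian planes\<close>

theorem theorem5p10:
  fixes \<zeta> :: complex
  assumes "prime CARD('p::prime_card)" and "odd CARD('p)"
    and "primitive_root_of_unity CARD('p) \<zeta>"
  shows "simplex_binder (gs_dim TYPE('p)) (gs_frame \<zeta> :: 'p grp \<times> 'p grp \<Rightarrow> complex vec) = AG_tilde"
proof -
  note odd = assms(2) and prim = assms(3)
  let ?f = "gs_frame \<zeta> :: 'p grp \<times> 'p grp \<Rightarrow> complex vec" and ?N = "CARD('p)\<^sup>2" and ?d = "gs_dim TYPE('p)"
  \<comment> \<open>Evenness lets the division in \<open>gs_dim\<close> act on this factor alone,
    which gives the number of blocks times the block length.\<close>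
  have "2 dvd ?N - 1" using odd by simp
  then have d: "?d = (?N - 1) div 2 * ?N"
    unfolding gs_dim_def by (simp add: div_mult_swap mult.commute)
  have fc: "?f x \<in> carrier_vec ?d" for x unfolding d by (rule gs_frame_carrier)
  note inner = gs_frame_cscalar_prod[OF odd prim]
  have norm: "?f x \<bullet>c ?f x = of_nat ?N - 1" for x
    by (simp add: inner chi_zero[OF prim])
  have unimod: "cmod (?f x \<bullet>c ?f y) = 1" if "x \<noteq> y" for x y
    using that by (simp add: inner cmod_chi[OF prim])
  have "is_simplex ?d ?f \<beta> \<longleftrightarrow> \<beta> \<in> AG_tilde" for \<beta>
  proof
    assume simplex: "is_simplex ?d ?f \<beta>"
    have N: "?N > 0" by simp
    have card: "card \<beta> = ?N"
      by (rule is_simplex_imp_phases(1)[OF N fc norm unimod simplex])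
    have "\<exists>\<delta>. (\<forall>j\<in>\<beta>. cmod (\<delta> j) = 1) \<and>
        (\<forall>i\<in>\<beta>. \<forall>j\<in>\<beta>. i \<noteq> j \<longrightarrow> \<delta> i * cnj (\<delta> j) * (?f i \<bullet>c ?f j) = -1)"
      by (rule is_simplex_imp_phases(2)[OF N fc norm unimod simplex])
    then obtain \<delta> where \<delta>: "\<And>j. j \<in> \<beta> \<Longrightarrow> cmod (\<delta> j) = 1"
      and \<delta>2: "\<And>i j. \<lbrakk>i \<in> \<beta>; j \<in> \<beta>; i \<noteq> j\<rbrakk> \<Longrightarrow> \<delta> i * cnj (\<delta> j) * (?f i \<bullet>c ?f j) = -1"
      by blast
    have \<delta>_cnj: "cnj (\<delta> j) * \<delta> j = 1" if "j \<in> \<beta>" for j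
      using \<delta>[OF that] by (simp add: mult.commute[of "cnj _"] complex_norm_square[symmetric])
    \<comment> \<open>The minus sign of the inner product cancels the \<open>-1\<close>. The case
      \<open>i = j\<close> is included so that triangles may have repeated vertices.\<close>
    have coboundary: "\<delta> i * cnj (\<delta> j) * chi \<zeta> (phase i j) = 1" if "i \<in> \<beta>" "j \<in> \<beta>" for i j
    proof (cases "i = j")
      case True
      then show ?thesis using \<delta>_cnj[of j] that by (simp add: chi_zero[OF prim] mult.commute)
    next
      case False
      then show ?thesis using \<delta>2[OF that] by (simp add: inner)
    qed
    have "symp (x - z) (y - z) = 0" if "x \<in> \<beta>" "y \<in> \<beta>" "z \<in> \<beta>" for x y z
    proof -
      \<comment> \<open>In the product around a triangle each phase meets its conjugate, and only
        the character of the triangle sum remains.\<close>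
      have "1 = (\<delta> x * cnj (\<delta> y) * chi \<zeta> (phase x y)) * (\<delta> y * cnj (\<delta> z) * chi \<zeta> (phase y z))
          * (\<delta> z * cnj (\<delta> x) * chi \<zeta> (phase z x))"
        using that by (simp add: coboundary)
      also have "\<dots> = (cnj (\<delta> x) * \<delta> x) * (cnj (\<delta> y) * \<delta> y) * (cnj (\<delta> z) * \<delta> z)
          * chi \<zeta> (phase x y + phase y z + phase z x)"
        by (simp add: chi_add[OF prim] mult_ac)
      finally have "chi \<zeta> (phase x y + phase y z + phase z x) = 1"
        using that by (simp add: \<delta>_cnj)
      then show ?thesis
        unfolding chi_eq_1_iff[OF prim] phase_cycle[OF odd, symmetric] by simp
    qed
    then show "\<beta> \<in> AG_tilde" using card by (intro isotropic_in_AG_tilde)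
  next
    assume \<beta>: "\<beta> \<in> AG_tilde"
    then have card: "card \<beta> = ?N" by (rule card_AG_tilde)
    then have "\<beta> \<noteq> {}" by auto
    then obtain z where z: "z \<in> \<beta>" by blast
    have cycle: "phase z x + phase x y + phase y z = 0" if "x \<in> \<beta>" "y \<in> \<beta>" for x y
    proof -
      have "2 * (phase z x + phase x y + phase y z) = 0"
        unfolding phase_cycle[OF odd] by (rule AG_tilde_isotropic[OF \<beta> z that])
      then show ?thesis using two_nonzero[OF odd] mult_eq_0_iff by blast
    qed
    \<comment> \<open>The phases are read off from the base vertex \<open>z\<close>; vanishing of
      the sums over triangles through \<open>z\<close> makes them trivialize every pair.\<close>
    show "is_simplex ?d ?f \<beta>"
    proof (rule phases_imp_is_simplex[where N = ?N and \<delta> = "\<lambda>x. chi \<zeta> (phase z x)"])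
      fix i j assume "i \<in> \<beta>" "j \<in> \<beta>" "i \<noteq> j"
      have "chi \<zeta> (phase z i) * cnj (chi \<zeta> (phase z j)) * chi \<zeta> (phase i j)
          = chi \<zeta> (phase z i + phase i j + phase j z)"
        by (simp only: cnj_chi[OF prim] chi_add[OF prim] phase_commute[of j z] mult_ac)
      then have "chi \<zeta> (phase z i) * cnj (chi \<zeta> (phase z j)) * chi \<zeta> (phase i j) = 1"
        using cycle \<open>i \<in> \<beta>\<close> \<open>j \<in> \<beta>\<close> by (simp add: chi_zero[OF prim])
      then show "chi \<zeta> (phase z i) * cnj (chi \<zeta> (phase z j)) * (?f i \<bullet>c ?f j) = -1"
        using \<open>i \<noteq> j\<close> by (simp add: inner)
    qed (use card fc norm cmod_chi[OF prim] in auto)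
  qed
  then show ?thesis by (auto simp: simplex_binder_def)
qed

end
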